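(* Let $\Bbbk$ be an algebraically closed field of characteristic zero. Let $A=\Bbbk\langle x,y\mid f\rangle$ and $A'=\Bbbk\langle x,y\mid f'\rangle$ with $f,f'\in\Bbbk\langle x,y\rangle$ of degree two, and let $M,M'\in\mathcal{M}_3(\Bbbk)$ be the defining matrices of $A$ and $A'$, respectively. If $M$ and $M'$ are standard-form congruent, then $A\cong A'$. Conversely, if $A\cong A'$, then $M$ and $M'$ are standard-form congruent unless $A\cong\mathfrak{U}$ and $A'\cong\mathfrak{V}$ (or vice-versa).
   Context: $\Bbbk\langle x,y\mid f\rangle$ is the quotient of the free associative unital $\Bbbk$-algebra by the two-sided ideal generated by $f$; isomorphisms are of $\Bbbk$-algebras. $\mathfrak{U}=\Bbbk\langle x,y\mid yx-xy+y\rangle$ and $\mathfrak{V}=\Bbbk\langle x,y\mid yx-xy+y^2+x\rangle$. Defining matrix: if $f=ax^2+bxy+cyx+dy^2+\alpha x+\beta y+\gamma$, the defining matrix of $\Bbbk\langle x,y\mid f\rangle$ is $\begin{pmatrix}a&b&\alpha\\c&d&\beta\\0&0&\gamma\end{pmatrix}$. Standard-form congruence: write $M\in\mathcal{M}_3(\Bbbk)$ in block form $M=\begin{pmatrix}M_1 & M_2\\ M_3^T & m\end{pmatrix}$ with $M_1\in\mathcal{M}_2(\Bbbk)$, $M_2,M_3\in\Bbbk^2$, $m\in\Bbbk$, and set $\mathrm{sf}(M)=\begin{pmatrix}M_1 & M_2+M_3\\ 0 & m\end{pmatrix}$. Let $\mathcal{P}_3=\left\{\begin{pmatrix}P_1&P_2\\0&1\end{pmatrix}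 : P_1\in \mathrm{GL}_2(\Bbbk),\ P_2\in\Bbbk^2\right\}$. Matrices $M,N\in\mathcal{M}_3(\Bbbk)$ are standard-form congruent if there exist $P\in\mathcal{P}_3$ and $\alpha\in\Bbbk^\times$ with $\mathrm{sf}(M)=\alpha\cdot\mathrm{sf}(P^TNP)$. *)

theory Defs
  imports
    "HOL-Analysis.Analysis"
    "HOL-Algebra.QuotRing"
    "HOL-Algebra.Module"
    "HOL-Library.Poly_Mapping"
begin

section \<open>The free algebra on two generators\<close>

text \<open>
  The free algebra is the monoid algebra of the free monoid of words. Multiplication on
  \<^typ>\<open>'a \<Rightarrow>\<^sub>0 'b\<close> is convolution with respect to addition of the exponents, so
  concatenation of words has to be written additively. A type of words separate from lists is used
  because HOL-Library already gives \<open>+\<close> on lists a different meaning.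
\<close>

datatype gen = X | Y

datatype 'a free_monoid = Word (letters: "'a list")

instantiation free_monoid :: (type) monoid_add
begin

definition zero_free_monoid :: "'a free_monoid"
  where "0 = Word []"

definition plus_free_monoid :: "'a free_monoid \<Rightarrow> 'a free_monoid \<Rightarrow> 'a free_monoid"
  where "u + v = Word (letters u @ letters v)"

instance
  by standard (simp_all add: zero_free_monoid_def plus_free_monoid_def)

end

type_synonym 'k free_poly = "gen free_monoid \<Rightarrow>\<^sub>0 'k"

definition var :: "gen \<Rightarrow> 'k::field free_poly"
  where "var g = Poly_Mapping.single (Word [g]) 1"

definition scalar :: "'k::field \<Rightarrow> 'k free_poly"
  where "scalar c = Poly_Mapping.single 0 c"

text \<open>The zero polynomial gets degree 0.\<close>

definition total_degree :: "'k::field free_poly \<Rightarrow> nat"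
  where "total_degree f = Max (insert 0 ((\<lambda>w. length (letters w)) ` Poly_Mapping.keys f))"

text \<open>
  The record type \<^typ>\<open>('k, 'a) module\<close> (a ring together with a scalar multiplication) is used
  for \<open>'k\<close>-algebras; the locale \<open>algebra\<close> of HOL-Algebra is not used, since it requires
  commutativity.
\<close>

definition free_algebra :: "('k::field, 'k free_poly) module"
  where "free_algebra =
    \<lparr>carrier = UNIV, mult = (*), one = 1, zero = 0, add = (+), smult = (\<lambda>c p. scalar c * p)\<rparr>"

lemma ring_free_algebra: "ring free_algebra"
proof (intro ringI abelian_groupI monoidI, goal_cases)
  case (6 p)
  show ?case
    by (rule bexI[of _ "- p"]) (simp_all add: free_algebra_def)
qed (simp_all add: free_algebra_def algebra_simps)


section \<open>The algebra presented by one relation\<close>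

definition quot_algebra :: "('k, 'a, 'm) module_scheme \<Rightarrow> 'a set \<Rightarrow> ('k, 'a set) module"
  where "quot_algebra R I =
    ring.extend (R Quot I)
      \<lparr>smult = (\<lambda>c A. \<Union>a\<in>A. I +>\<^bsub>R\<^esub> (c \<odot>\<^bsub>R\<^esub> a))\<rparr>"

definition presented_algebra :: "'k::field free_poly \<Rightarrow> ('k, 'k free_poly set) module"
  where "presented_algebra f = quot_algebra free_algebra (Idl\<^bsub>free_algebra\<^esub> {f})"

definition alg_iso ::
    "('k, 'a, 'm) module_scheme \<Rightarrow> ('k, 'b, 'n) module_scheme \<Rightarrow> ('a \<Rightarrow> 'b) set"
  where "alg_iso A B =
    {h \<in> ring_iso A B. \<forall>c. \<forall>a\<in>carrier A. h (c \<odot>\<^bsub>A\<^esub> a) = c \<odot>\<^bsub>B\<^esub> h a}"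

definition alg_isomorphic ::
    "('k, 'a, 'm) module_scheme \<Rightarrow> ('k, 'b, 'n) module_scheme \<Rightarrow> bool"
    (infix \<open>\<cong>\<^sub>a\<close> 50)
  where "A \<cong>\<^sub>a B \<longleftrightarrow> alg_iso A B \<noteq> {}"

definition algebra_U :: "('k::field, 'k free_poly set) module"
  where "algebra_U = presented_algebra (var Y * var X - var X * var Y + var Y)"

definition algebra_V :: "('k::field, 'k free_poly set) module"
  where "algebra_V = presented_algebra (var Y * var X - var X * var Y + var Y ^ 2 + var X)"

lemma ideal_relation: "ideal (Idl\<^bsub>free_algebra\<^esub> {f}) free_algebra"
  by (rule ring.genideal_ideal[OF ring_free_algebra]) (simp add: free_algebra_def)

lemma ring_presented_algebra: "ring (presented_algebra f)"
proof -
  let ?Q = "free_algebra Quot (Idl\<^bsub>free_algebra\<^esub> {f})"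
  interpret Q: ring ?Q
    by (rule ideal.quotient_is_ring[OF ideal_relation])
  have sel: "carrier (presented_algebra f) = carrier ?Q"
    "monoid.mult (presented_algebra f) = monoid.mult ?Q"
    "one (presented_algebra f) = one ?Q"
    "zero (presented_algebra f) = zero ?Q"
    "add (presented_algebra f) = add ?Q"
    by (simp_all add: presented_algebra_def quot_algebra_def ring.defs)
  show ?thesis
  proof (intro ringI abelian_groupI monoidI, goal_cases)
    case (6 p)
    then show ?case
      by (intro bexI[of _ "\<ominus>\<^bsub>?Q\<^esub> p"]) (simp_all add: sel Q.l_neg)
  qed (simp_all only: sel Q.a_closed Q.zero_closed Q.a_ac Q.l_zero Q.r_zero Q.m_closed
      Q.one_closed Q.m_assoc Q.l_one Q.r_one Q.l_distr Q.r_distr)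
qed

lemma smult_presented_algebra:
  fixes f p :: "'k::field free_poly"
  defines "I \<equiv> Idl\<^bsub>free_algebra\<^esub> {f}"
  shows "c \<odot>\<^bsub>presented_algebra f\<^esub> (I +>\<^bsub>free_algebra\<^esub> p) = I +>\<^bsub>free_algebra\<^esub> (scalar c * p)"
proof -
  interpret ideal I "free_algebra :: ('k, 'k free_poly) module"
    unfolding I_def by (rule ideal_relation)
  have S: "a \<in> carrier free_algebra" for a :: "'k free_poly"
    by (simp add: free_algebra_def)
  have eq: "I +>\<^bsub>free_algebra\<^esub> (scalar c * a) = I +>\<^bsub>free_algebra\<^esub> (scalar c * p)"
    if a: "a \<in> I +>\<^bsub>free_algebra\<^esub> p" for a
  proof (rule a_repr_independence'[symmetric])
    from a obtain i where i: "i \<in> I" "a = i + p"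
      by (auto simp: a_r_coset_def' free_algebra_def)
    have "scalar c * i \<in> I"
      using I_l_closed[OF i(1) S] by (simp add: free_algebra_def)
    with i show "scalar c * a \<in> I +>\<^bsub>free_algebra\<^esub> (scalar c * p)"
      by (auto simp: a_r_coset_def' free_algebra_def distrib_left)
  qed (rule S)
  moreover have "p \<in> I +>\<^bsub>free_algebra\<^esub> p"
    by (rule a_rcos_self[OF S])
  ultimately have "(\<Union>a\<in>I +>\<^bsub>free_algebra\<^esub> p. I +>\<^bsub>free_algebra\<^esub> (scalar c * a))
      = I +>\<^bsub>free_algebra\<^esub> (scalar c * p)"
    by blast
  then show ?thesis
    unfolding presented_algebra_def quot_algebra_def I_def[symmetric]
    by (simp add: ring.defs free_algebra_def)
qed


section \<open>Standard-form congruence\<close>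

text \<open>\<open>block_matrix M1 M2 M3 m\<close> is the matrix with rows \<open>(M1 | M2)\<close> and \<open>(M3\<^sup>T | m)\<close>.\<close>

definition block_matrix :: "'k::field^2^2 \<Rightarrow> 'k^2 \<Rightarrow> 'k^2 \<Rightarrow> 'k \<Rightarrow> 'k^3^3"
  where "block_matrix M1 M2 M3 m = vector
    [vector [M1$1$1, M1$1$2, M2$1],
     vector [M1$2$1, M1$2$2, M2$2],
     vector [M3$1,   M3$2,   m]]"

definition sf :: "'k::field^3^3 \<Rightarrow> 'k^3^3"
  where "sf M =
    (let M1 = vector [vector [M$1$1, M$1$2], vector [M$2$1, M$2$2]];
         M2 = vector [M$1$3, M$2$3];
         M3 = vector [M$3$1, M$3$2]
     in block_matrix M1 (M2 + M3) 0 (M$3$3))"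

lemma sf_block_matrix: "sf (block_matrix M1 M2 M3 m) = block_matrix M1 (M2 + M3) 0 m"
  by (simp add: sf_def block_matrix_def)

definition P3 :: "('k::field^3^3) set"
  where "P3 = {block_matrix P1 P2 0 1 | P1 P2. invertible P1}"

definition sf_congruent :: "'k::field^3^3 \<Rightarrow> 'k^3^3 \<Rightarrow> bool"
  where "sf_congruent M N \<longleftrightarrow>
    (\<exists>P\<in>P3. \<exists>\<alpha>. \<alpha> \<noteq> 0 \<and> sf M = (\<chi> i j. \<alpha> * sf (transpose P ** N ** P) $ i $ j))"

definition defining_matrix :: "'k::field free_poly \<Rightarrow> 'k^3^3"
  where "defining_matrix f =
    (let coeff = (\<lambda>w. Poly_Mapping.lookup f (Word w))
     in vector
      [vector [coeff [X,X], coeff [X,Y], coeff [X]],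
       vector [coeff [Y,X], coeff [Y,Y], coeff [Y]],
       vector [0,           0,           coeff []]])"

lemma defining_matrix_expand:
  assumes "total_degree f \<le> 2"
  shows "f = (let M = defining_matrix f in
      scalar (M$1$1) * var X * var X + scalar (M$1$2) * var X * var Y
    + scalar (M$2$1) * var Y * var X + scalar (M$2$2) * var Y * var Y
    + scalar (M$1$3) * var X + scalar (M$2$3) * var Y + scalar (M$3$3))"
proof (rule poly_mapping_eqI, goal_cases)
  case (1 w)
  obtain l where w: "w = Word l" by (cases w)
  note simps = Let_def scalar_def var_def mult_single lookup_add lookup_single when_def
    zero_free_monoid_def plus_free_monoid_def defining_matrix_def
  consider "length l > 2" | "l = []" | a where "l = [a]" | a b where "l = [a, b]"
    by (cases l; cases "tl l"; cases "tl (tl l)") auto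
  then show ?case
  proof cases
    case 1
    have "w \<notin> Poly_Mapping.keys f"
    proof
      assume "w \<in> Poly_Mapping.keys f"
      then have "length l \<le> total_degree f"
        unfolding total_degree_def by (intro Max_ge) (auto simp: w intro!: rev_image_eqI)
      with 1 assms show False by simp
    qed
    then have "Poly_Mapping.lookup f w = 0" by (simp add: in_keys_iff)
    with 1 show ?thesis by (auto simp: w simps)
  next
    case 2
    then show ?thesis by (simp add: w simps)
  next
    case 3
    then show ?thesis by (cases a) (simp_all add: w simps)
  next
    case 4
    then show ?thesis by (cases a; cases b) (simp_all add: w simps)
  qed
qed

end

theory Submission
  imports Defs
begin

text \<open>
  Standard-form congruence is affine equivalence in disguise: the relation with defining matrix
  \<open>N\<close> is \<open>v\<^sup>T N v\<close> with \<open>v = (x, y, 1)\<^sup>T\<close>, the matrices in \<open>\<P>\<^sub>3\<close> are the affine substitutions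
  \<open>v \<mapsto> P v\<close>, and passing to the standard form merely collects the linear terms. Hence \<open>M\<close> and
  \<open>M'\<close> are standard-form congruent if and only if \<open>f\<close> is a nonzero multiple of an affine
  substitution instance of \<open>f'\<close> (\<open>sf_congruent_iff_aff_equiv\<close>). An affine substitution is an
  automorphism of the free algebra, so it induces an isomorphism of the presented algebras; this
  is the first half.

  For the second half, every relation of degree two is affinely equivalent to one of
  \<open>xy - qyx + e\<close>, \<open>yx - xy + y\<^sup>2 + e\<close>, \<open>y\<^sup>2 + e\<close> (with \<open>e\<close> either \<open>0\<close> or \<open>1\<close>), \<open>y\<^sup>2 + x\<close>, or the
  relation of \<open>\<UU>\<close> or of \<open>\<VV>\<close> (\<open>quadratic_classification\<close>). The algebras \<open>\<UU>\<close> and \<open>\<VV>\<close> are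
  isomorphic by a nonlinear automorphism of the free algebra, so the exceptional case of the theorem says
  that both algebras are isomorphic to \<open>\<UU>\<close>. It remains to see that isomorphic algebras among the
  other normal forms have affinely equivalent relations.

  For this, consider the one-dimensional representations of an algebra, that is, the points of
  the affine conic \<open>f(x, y) = 0\<close>, and call two points \<open>P\<close>, \<open>Q\<close> linked if every pair of upper
  triangular \<open>2 \<times> 2\<close> matrices with diagonals given by \<open>P\<close> and \<open>Q\<close> satisfies the relation. An
  isomorphism of algebras induces mutually inverse polynomial maps between the sets of points that
  preserve links (\<open>point_embedding_of_lift\<close>). For a quadratic relation, being linked amounts to two
  linear equations. For \<open>xy - qyx + e\<close> with \<open>q \<noteq> 0\<close> the links are the graph of the automorphism
  \<open>(x, y) \<mapsto> (x/q, qy)\<close> of the conic, for \<open>yx - xy + y\<^sup>2 + e\<close> they are the graph of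
  \<open>(x, y) \<mapsto> (x - 2y, y)\<close>, for \<open>y\<^sup>2 + e\<close> they form the relation \<open>y + y' = 0\<close>, and for \<open>y\<^sup>2 + x\<close> there
  are none. Crude properties of this relation (is it empty, functional, symmetric, does it have
  fixed points) separate most of the normal forms. The remaining pairs are separated by
  polynomial maps: there is no nonconstant polynomial map from a line to a hyperbola
  (\<open>no_line_on_hyperbola\<close>) and no injective one from a plane to a line (\<open>no_plane_on_line\<close>). Finally, the
  parameter \<open>q\<close> is determined up to inversion, because an isomorphism acts affinely on the
  coordinate axes if \<open>e = 0\<close> and by \<open>t \<mapsto> a t\<^sup>\<plusminus>\<^sup>1\<close> on the hyperbola if \<open>e = 1\<close>
  (\<open>q_form_0_parameter\<close>, \<open>q_form_1_parameter\<close>); and \<open>q\<close> and \<open>1/q\<close> do give affinely equivalent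
  relations, by exchanging the variables.
\<close>

section \<open>Evaluation homomorphisms of the free algebra\<close>

lemma single_word_eq:
  "Poly_Mapping.single (Word l) c = scalar c * prod_list (map var l)"
proof (induction l arbitrary: c)
  case Nil
  then show ?case by (simp add: scalar_def zero_free_monoid_def)
next
  case (Cons g l)
  have "Poly_Mapping.single (Word (g # l)) c
      = scalar c * (var g * Poly_Mapping.single (Word l) 1)"
    by (simp add: scalar_def var_def mult_single zero_free_monoid_def plus_free_monoid_def)
  also have "Poly_Mapping.single (Word l) 1 = prod_list (map var l :: 'a free_poly list)"
    using Cons.IH[of 1] by (simp add: scalar_def)
  finally show ?case by simp
qed

lemma free_poly_monomial_induct [case_names zero single add]:
  fixes p :: "'k::field free_poly"
  assumes "P 0"
    and "\<And>l c. P (Poly_Mapping.single (Word l) c)"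
    and "\<And>p q. P p \<Longrightarrow> P q \<Longrightarrow> P (p + q)"
  shows "P p"
proof (induction p rule: update_induct)
  case const
  show ?case by fact
next
  case (update p w c)
  have "Poly_Mapping.update w c p = p + Poly_Mapping.single w c"
    using update.hyps(1)
    by (intro poly_mapping_eqI) (auto simp: lookup_update lookup_add lookup_single when_def in_keys_iff)
  moreover obtain l where "w = Word l" by (cases w)
  ultimately show ?case using assms(2,3) update.IH by simp
qed

text \<open>
  The free algebra is generated as a ring by the scalars and the variables; this is how homomorphisms
  are compared below.
\<close>

lemma free_poly_induct [case_names scalar var add mult]:
  fixes p :: "'k::field free_poly"
  assumes scalar: "\<And>c. P (scalar c)"
    and var: "\<And>g. P (var g)"
    and add: "\<And>p q. P p \<Longrightarrow> P q \<Longrightarrow> P (p + q)"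
    and mult: "\<And>p q. P p \<Longrightarrow> P q \<Longrightarrow> P (p * q)"
  shows "P p"
proof (induction p rule: free_poly_monomial_induct)
  case zero
  show ?case using scalar[of 0] by (simp add: scalar_def)
next
  case (single l c)
  have "P (prod_list (map var l))"
    by (induction l) (use scalar[of 1] in \<open>auto simp: scalar_def intro: mult var\<close>)
  then show ?case by (simp add: single_word_eq mult scalar)
qed (rule add)

text \<open>
  The homomorphism into the ring \<open>'r\<close> that is \<open>s\<close> on scalars and \<open>g\<close> on the generators. It is needed for
  values at a point (\<open>'r\<close> the field), for upper triangular matrices, and for substitutions (\<open>'r\<close> the
  free algebra itself).
\<close>

definition ev :: "('k::field \<Rightarrow> 'r::ring_1) \<Rightarrow> (gen \<Rightarrow> 'r) \<Rightarrow> 'k free_poly \<Rightarrow> 'r"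
  where "ev s g p =
    (\<Sum>w\<in>Poly_Mapping.keys p. s (Poly_Mapping.lookup p w) * prod_list (map g (letters w)))"

locale central_scalars =
  fixes s :: "'k::field \<Rightarrow> 'r::ring_1"
  assumes s_add: "s (c + d) = s c + s d"
    and s_mult: "s (c * d) = s c * s d"
    and s_one: "s 1 = 1"
    and s_central: "s c * z = z * s c"
begin

lemma s_zero: "s 0 = 0"
  using s_add[of 0 0] by simp

lemma ev_superset:
  assumes "finite W" "Poly_Mapping.keys p \<subseteq> W"
  shows "ev s g p = (\<Sum>w\<in>W. s (Poly_Mapping.lookup p w) * prod_list (map g (letters w)))"
  unfolding ev_def using assms
  by (intro sum.mono_neutral_left) (auto simp: s_zero in_keys_iff)

lemma ev_zero: "ev s g 0 = 0"
  by (simp add: ev_def)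

lemma ev_add: "ev s g (p + q) = ev s g p + ev s g q"
proof -
  let ?W = "Poly_Mapping.keys p \<union> Poly_Mapping.keys q"
  have "ev s g r = (\<Sum>w\<in>?W. s (Poly_Mapping.lookup r w) * prod_list (map g (letters w)))"
    if "r \<in> {p, q, p + q}" for r
    using that keys_add[of p q] by (intro ev_superset) auto
  then show ?thesis
    by (simp add: lookup_add s_add distrib_right sum.distrib)
qed

lemma ev_single: "ev s g (Poly_Mapping.single (Word l) c) = s c * prod_list (map g l)"
  by (simp add: ev_def s_zero)

lemma ev_mult: "ev s g (p * q) = ev s g p * ev s g q"
proof (induction p rule: free_poly_monomial_induct)
  case (single l c)
  show ?case
  proof (induction q rule: free_poly_monomial_induct)
    case (single m d)
    have "ev s g (Poly_Mapping.single (Word l) c * Poly_Mapping.single (Word m) d)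
        = s c * (s d * prod_list (map g l)) * prod_list (map g m)"
      by (simp add: mult_single plus_free_monoid_def ev_single s_mult mult.assoc)
    also have "s d * prod_list (map g l) = prod_list (map g l) * s d"
      by (rule s_central)
    finally show ?case
      by (simp add: ev_single mult.assoc)
  qed (simp_all add: ev_zero ev_add distrib_left)
qed (simp_all add: ev_zero ev_add distrib_right)

lemma ev_scalar: "ev s g (scalar c) = s c"
  using ev_single[of g "[]" c] by (simp add: scalar_def zero_free_monoid_def)

lemma ev_var: "ev s g (var v) = g v"
  using ev_single[of g "[v]" 1] by (simp add: var_def s_one)

lemma ev_one: "ev s g 1 = 1"
  using ev_scalar[of g 1] by (simp add: scalar_def s_one)

lemma ev_diff: "ev s g (p - q) = ev s g p - ev s g q"
  using ev_add[of g "p - q" q] by (simp add: algebra_simps)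

lemma ev_minus: "ev s g (- p) = - ev s g p"
  using ev_diff[of g 0 p] by (simp add: ev_zero)

lemma ev_power: "ev s g (p ^ n) = ev s g p ^ n"
  by (induction n) (simp_all add: ev_one ev_mult)

lemmas ev_simps = ev_zero ev_one ev_add ev_diff ev_minus ev_mult ev_scalar ev_var ev_power

end

lemma scalar_add: "scalar (a + b) = scalar a + scalar b"
  by (simp add: scalar_def single_add)

lemma scalar_mult: "scalar (a * b) = scalar a * scalar b"
  by (simp add: scalar_def mult_single)

lemma scalar_0 [simp]: "scalar 0 = 0"
  by (simp add: scalar_def)

lemma scalar_1 [simp]: "scalar 1 = 1"
  by (simp add: scalar_def)

lemma scalar_minus: "scalar (- a) = - scalar a"
  by (simp add: scalar_def single_uminus)

lemma scalar_central: "scalar c * p = p * scalar c"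
  by (induction p rule: free_poly_monomial_induct)
    (simp_all add: scalar_def mult_single algebra_simps)

interpretation subst: central_scalars scalar
  by (unfold_locales; (rule scalar_add scalar_mult scalar_1 scalar_central)?)

abbreviation subst :: "(gen \<Rightarrow> 'k::field free_poly) \<Rightarrow> 'k free_poly \<Rightarrow> 'k free_poly"
  where "subst \<equiv> ev scalar"

lemma subst_var: "subst var p = p"
  by (induction p rule: free_poly_induct) (simp_all add: subst.ev_simps)

lemma (in central_scalars) ev_subst: "ev s g (subst h p) = ev s (\<lambda>v. ev s g (h v)) p"
  by (induction p rule: free_poly_induct) (simp_all add: ev_simps subst.ev_simps)

section \<open>Presented algebras and their isomorphisms\<close>

abbreviation rel_ideal :: "'k::field free_poly \<Rightarrow> 'k free_poly set"
  where "rel_ideal f \<equiv> Idl\<^bsub>free_algebra\<^esub> {f}"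

abbreviation cls :: "'k::field free_poly \<Rightarrow> 'k free_poly \<Rightarrow> 'k free_poly set"
  where "cls f p \<equiv> rel_ideal f +>\<^bsub>free_algebra\<^esub> p"

lemma cls_eq: "cls f p = (\<lambda>i. i + p) ` rel_ideal f"
  by (auto simp: a_r_coset_def' free_algebra_def)

lemma rel_ideal_gen: "f \<in> rel_ideal f"
  using ring.genideal_self'[OF ring_free_algebra] by (simp add: free_algebra_def)

lemma rel_ideal_add:
  assumes "p \<in> rel_ideal f" "q \<in> rel_ideal f"
  shows "p + q \<in> rel_ideal f"
  using additive_subgroup.a_closed[OF ideal.axioms(1)[OF ideal_relation] assms]
  by (simp add: free_algebra_def)

lemma rel_ideal_mult:
  assumes "p \<in> rel_ideal f"
  shows "q * p \<in> rel_ideal f" "p * q \<in> rel_ideal f"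
  using ideal.I_l_closed[OF ideal_relation assms] ideal.I_r_closed[OF ideal_relation assms]
  by (simp_all add: free_algebra_def)

lemma rel_ideal_zero: "0 \<in> rel_ideal f"
  using rel_ideal_mult(1)[OF rel_ideal_gen, of 0 f] by simp

lemma rel_ideal_minus: "p \<in> rel_ideal f \<Longrightarrow> - p \<in> rel_ideal f"
  using rel_ideal_mult(1)[of p f "- 1"] by simp

text \<open>
  Closure under negation comes for free, by multiplying with \<open>-1\<close>.
\<close>

lemma rel_ideal_minimal:
  assumes "f \<in> I" "0 \<in> I" "\<And>p q. p \<in> I \<Longrightarrow> q \<in> I \<Longrightarrow> p + q \<in> I"
    "\<And>p q. p \<in> I \<Longrightarrow> q * p \<in> I" "\<And>p q. p \<in> I \<Longrightarrow> p * q \<in> I"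
  shows "rel_ideal f \<subseteq> I"
proof (rule ring.genideal_minimal[OF ring_free_algebra])
  interpret ring "free_algebra :: ('a, 'a free_poly) module" by (rule ring_free_algebra)
  have minv: "\<ominus>\<^bsub>free_algebra\<^esub> p = - p" for p :: "'a free_poly"
    by (rule minus_equality) (simp_all add: free_algebra_def)
  show "ideal I free_algebra"
  proof (rule idealI[OF ring_free_algebra])
    show "subgroup I (add_monoid free_algebra)"
    proof (rule add.subgroupI)
      fix p assume "p \<in> I"
      then show "\<ominus>\<^bsub>free_algebra\<^esub> p \<in> I"
        using assms(4)[of p "- 1"] by (simp add: minv)
    qed (use assms in \<open>auto simp: free_algebra_def\<close>)
  qed (use assms in \<open>auto simp: free_algebra_def\<close>)
qed (use assms in auto)

lemma cls_eq_iff: "cls f p = cls f q \<longleftrightarrow> p - q \<in> rel_ideal f"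
proof
  assume "cls f p = cls f q"
  then have "p \<in> cls f q"
    using rel_ideal_zero[of f] unfolding cls_eq by force
  then show "p - q \<in> rel_ideal f" by (auto simp: cls_eq)
next
  have *: "cls f p \<subseteq> cls f q" if "p - q \<in> rel_ideal f" for p q
    using rel_ideal_add[OF _ that] unfolding cls_eq
    by (auto intro!: image_eqI[of _ _ "_ + (p - q)"])
  assume "p - q \<in> rel_ideal f"
  with *[of p q] *[of q p] rel_ideal_minus[of "p - q" f] show "cls f p = cls f q"
    by auto
qed

lemma presented_algebra_simps:
  fixes f p q :: "'k::field free_poly"
  shows "carrier (presented_algebra f) = range (cls f)"
    and "cls f p \<otimes>\<^bsub>presented_algebra f\<^esub> cls f q = cls f (p * q)"
    and "cls f p \<oplus>\<^bsub>presented_algebra f\<^esub> cls f q = cls f (p + q)"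
    and "\<one>\<^bsub>presented_algebra f\<^esub> = cls f 1"
    and "c \<odot>\<^bsub>presented_algebra f\<^esub> cls f p = cls f (scalar c * p)"
proof -
  interpret ideal "rel_ideal f" "free_algebra :: ('k, 'k free_poly) module"
    by (rule ideal_relation)
  have sel: "carrier (presented_algebra f) = a_rcosets\<^bsub>free_algebra\<^esub> (rel_ideal f)"
    "monoid.mult (presented_algebra f) = rcoset_mult free_algebra (rel_ideal f)"
    "one (presented_algebra f) = cls f \<one>\<^bsub>free_algebra\<^esub>"
    "add (presented_algebra f) = set_add free_algebra"
    by (simp_all add: presented_algebra_def quot_algebra_def ring.defs FactRing_def)
  have S: "a \<in> carrier free_algebra" for a :: "'k free_poly"
    by (simp add: free_algebra_def)
  show "carrier (presented_algebra f) = range (cls f)"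
    by (auto simp: sel A_RCOSETS_def' cls_eq a_r_coset_def' free_algebra_def)
  show "cls f p \<otimes>\<^bsub>presented_algebra f\<^esub> cls f q = cls f (p * q)"
    using rcoset_mult_add[OF S S, of p q] by (simp add: sel) (simp add: free_algebra_def)
  show "cls f p \<oplus>\<^bsub>presented_algebra f\<^esub> cls f q = cls f (p + q)"
    using a_rcos_sum[OF S S, of p q] by (simp add: sel) (simp add: free_algebra_def)
  show "\<one>\<^bsub>presented_algebra f\<^esub> = cls f 1"
    by (simp add: sel) (simp add: free_algebra_def)
qed (rule smult_presented_algebra)

lemma alg_isomorphic_sym:
  assumes "presented_algebra f \<cong>\<^sub>a presented_algebra g"
  shows "presented_algebra g \<cong>\<^sub>a presented_algebra f"
proof -
  let ?A = "presented_algebra f" and ?B = "presented_algebra g"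
  interpret A: ring ?A by (rule ring_presented_algebra)
  obtain h where h: "h \<in> ring_iso ?A ?B"
    and sm: "\<And>c a. a \<in> carrier ?A \<Longrightarrow> h (c \<odot>\<^bsub>?A\<^esub> a) = c \<odot>\<^bsub>?B\<^esub> h a"
    using assms unfolding alg_isomorphic_def alg_iso_def by blast
  let ?k = "inv_into (carrier ?A) h"
  have bij: "bij_betw h (carrier ?A) (carrier ?B)"
    by (rule ring_iso_memE(5)[OF h])
  have "?k \<in> ring_iso ?B ?A"
    by (rule ring_iso_set_sym[OF A.ring_axioms h])
  moreover have "?k (c \<odot>\<^bsub>?B\<^esub> b) = c \<odot>\<^bsub>?A\<^esub> ?k b" if "b \<in> carrier ?B" for c b
  proof -
    have kb: "?k b \<in> carrier ?A" "h (?k b) = b"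
      using bij that by (auto simp: bij_betw_def inv_into_into f_inv_into_f)
    then obtain p where "?k b = cls f p"
      by (auto simp: presented_algebra_simps)
    then have "c \<odot>\<^bsub>?A\<^esub> ?k b \<in> carrier ?A"
      by (simp add: presented_algebra_simps)
    then have "?k (h (c \<odot>\<^bsub>?A\<^esub> ?k b)) = c \<odot>\<^bsub>?A\<^esub> ?k b"
      using bij by (simp add: bij_betw_def)
    then show ?thesis using sm[OF kb(1)] kb(2) by simp
  qed
  ultimately show ?thesis unfolding alg_isomorphic_def alg_iso_def by blast
qed

lemma alg_isomorphic_trans:
  assumes "A \<cong>\<^sub>a B" "B \<cong>\<^sub>a C"
  shows "A \<cong>\<^sub>a C"
proof -
  obtain h k where h: "h \<in> ring_iso A B" "\<And>c a. a \<in> carrier A \<Longrightarrow> h (c \<odot>\<^bsub>A\<^esub> a) = c \<odot>\<^bsub>B\<^esub> h a"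
    and k: "k \<in> ring_iso B C" "\<And>c b. b \<in> carrier B \<Longrightarrow> k (c \<odot>\<^bsub>B\<^esub> b) = c \<odot>\<^bsub>C\<^esub> k b"
    using assms unfolding alg_isomorphic_def alg_iso_def by blast
  have "k \<circ> h \<in> ring_iso A C"
    by (rule ring_iso_set_trans[OF h(1) k(1)])
  with h(2) k(2) ring_iso_memE(1)[OF h(1)] have "k \<circ> h \<in> alg_iso A C"
    by (simp add: alg_iso_def)
  then show ?thesis unfolding alg_isomorphic_def by blast
qed

text \<open>
  The automorphism \<open>\<psi>\<close> inverse to \<open>\<phi>\<close> maps the ideal of \<open>f\<close> onto the ideal of \<open>g\<close>. The induced map on
  cosets is therefore just the direct image under \<open>\<psi>\<close>.
\<close>

lemma isomorphic_of_automorphism: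
  fixes f g :: "'k::field free_poly" and \<phi> \<psi> :: "gen \<Rightarrow> 'k free_poly"
  assumes inv: "\<And>v. subst \<psi> (\<phi> v) = var v" "\<And>v. subst \<phi> (\<psi> v) = var v"
    and c: "c \<noteq> 0" and fg: "f = scalar c * subst \<phi> g"
  shows "presented_algebra f \<cong>\<^sub>a presented_algebra g"
proof -
  let ?A = "presented_algebra f" and ?B = "presented_algebra g"
  have \<psi>\<phi>: "subst \<psi> (subst \<phi> p) = p" and \<phi>\<psi>: "subst \<phi> (subst \<psi> p) = p" for p
    by (simp_all add: subst.ev_subst inv subst_var)
  have cc: "scalar (1 / c) * scalar c = 1"
    using c by (simp flip: scalar_mult)
  have \<phi>g: "subst \<phi> g = scalar (1 / c) * f"
    by (simp add: fg mult.assoc[symmetric] cc)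
  have 1: "subst \<psi> p \<in> rel_ideal g" if "p \<in> rel_ideal f" for p
  proof -
    have "rel_ideal f \<subseteq> {p. subst \<psi> p \<in> rel_ideal g}"
      by (rule rel_ideal_minimal)
        (auto simp: subst.ev_simps fg \<psi>\<phi> rel_ideal_gen rel_ideal_add rel_ideal_mult rel_ideal_zero)
    with that show ?thesis by blast
  qed
  have 2: "subst \<phi> p \<in> rel_ideal f" if "p \<in> rel_ideal g" for p
  proof -
    have "rel_ideal g \<subseteq> {p. subst \<phi> p \<in> rel_ideal f}"
      by (rule rel_ideal_minimal)
        (auto simp: subst.ev_simps \<phi>g rel_ideal_gen rel_ideal_add rel_ideal_mult rel_ideal_zero)
    with that show ?thesis by blast
  qed
  have im: "subst \<psi> ` rel_ideal f = rel_ideal g"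
  proof
    show "subst \<psi> ` rel_ideal f \<subseteq> rel_ideal g" using 1 by blast
    show "rel_ideal g \<subseteq> subst \<psi> ` rel_ideal f"
    proof
      fix p assume "p \<in> rel_ideal g"
      from 2[OF this] show "p \<in> subst \<psi> ` rel_ideal f"
        using \<psi>\<phi>[of p] by (metis image_eqI)
    qed
  qed
  have cls: "subst \<psi> ` cls f p = cls g (subst \<psi> p)" for p
    unfolding cls_eq by (simp add: image_image subst.ev_add flip: im)
  have inj: "inj (subst \<psi>)"
    by (rule inj_on_inverseI) (rule \<phi>\<psi>)
  have "(`) (subst \<psi>) \<in> alg_iso ?A ?B"
    unfolding alg_iso_def
  proof (intro CollectI conjI ring_iso_memI ballI allI)
    show "bij_betw ((`) (subst \<psi>)) (carrier ?A) (carrier ?B)"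
      unfolding bij_betw_def
    proof
      show "inj_on ((`) (subst \<psi>)) (carrier ?A)"
        by (rule inj_onI) (metis inj inj_image_eq_iff)
      have "cls g p \<in> (`) (subst \<psi>) ` range (cls f)" for p
        using cls[of "subst \<phi> p"] by (auto simp: \<psi>\<phi>)
      then show "(`) (subst \<psi>) ` carrier ?A = carrier ?B"
        by (auto simp: presented_algebra_simps cls)
    qed
  qed (auto simp: presented_algebra_simps cls subst.ev_simps del: equalityI subsetI)
  then show ?thesis unfolding alg_isomorphic_def by blast
qed

text \<open>
  Choosing representatives of the images of the generators lifts an isomorphism of the quotients
  and its inverse to endomorphisms of the free algebra, which are inverse to each other only modulo
  the relations.
\<close>

lemma isomorphic_lift:
  fixes f g :: "'k::field free_poly"
  assumes "presented_algebra f \<cong>\<^sub>a presented_algebra g"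
  obtains \<phi> \<psi> :: "gen \<Rightarrow> 'k free_poly" where
    "subst \<phi> f \<in> rel_ideal g" "subst \<psi> g \<in> rel_ideal f"
    "\<And>v. subst \<psi> (\<phi> v) - var v \<in> rel_ideal f" "\<And>v. subst \<phi> (\<psi> v) - var v \<in> rel_ideal g"
proof -
  let ?A = "presented_algebra f" and ?B = "presented_algebra g"
  obtain h where h: "h \<in> ring_iso ?A ?B"
    and sm: "\<And>c a. a \<in> carrier ?A \<Longrightarrow> h (c \<odot>\<^bsub>?A\<^esub> a) = c \<odot>\<^bsub>?B\<^esub> h a"
    using assms unfolding alg_isomorphic_def alg_iso_def by blast
  have bij: "bij_betw h (range (cls f)) (range (cls g))"
    using ring_iso_memE(5)[OF h] by (simp add: presented_algebra_simps)
  have carr: "cls f p \<in> carrier ?A" for p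
    by (simp add: presented_algebra_simps)
  have "\<exists>q. h (cls f p) = cls g q" for p
  proof -
    have "h (cls f p) \<in> range (cls g)" using bij by (meson bij_betwE rangeI)
    then show ?thesis by blast
  qed
  then have "\<forall>v. \<exists>q. h (cls f (var v)) = cls g q" by blast
  from choice[OF this] obtain \<phi> where \<phi>: "\<And>v. h (cls f (var v)) = cls g (\<phi> v)"
    by blast
  have h\<phi>: "h (cls f p) = cls g (subst \<phi> p)" for p
  proof (induction p rule: free_poly_induct)
    case (scalar c)
    have "h (cls f (scalar c)) = h (c \<odot>\<^bsub>?A\<^esub> cls f 1)"
      by (simp add: presented_algebra_simps)
    also have "\<dots> = c \<odot>\<^bsub>?B\<^esub> h (\<one>\<^bsub>?A\<^esub>)"
      by (simp add: sm carr presented_algebra_simps(4))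
    also have "\<dots> = cls g (scalar c)"
      using ring_iso_memE(4)[OF h] by (simp add: presented_algebra_simps)
    finally show ?case by (simp add: subst.ev_simps)
  next
    case (var v)
    show ?case by (simp add: subst.ev_simps \<phi>)
  next
    case (add p q)
    have "h (cls f (p + q)) = h (cls f p) \<oplus>\<^bsub>?B\<^esub> h (cls f q)"
      using ring_iso_memE(3)[OF h carr carr, of p q] by (simp add: presented_algebra_simps)
    with add show ?case by (simp add: subst.ev_simps presented_algebra_simps)
  next
    case (mult p q)
    have "h (cls f (p * q)) = h (cls f p) \<otimes>\<^bsub>?B\<^esub> h (cls f q)"
      using ring_iso_memE(2)[OF h carr carr, of p q] by (simp add: presented_algebra_simps)
    with mult show ?case by (simp add: subst.ev_simps presented_algebra_simps)
  qed
  have "\<exists>p. h (cls f p) = cls g q" for q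
  proof -
    have "cls g q \<in> h ` range (cls f)" using bij by (simp add: bij_betw_def)
    then show ?thesis by blast
  qed
  then have "\<forall>v. \<exists>p. h (cls f p) = cls g (var v)" by blast
  from choice[OF this] obtain \<psi> where \<psi>: "\<And>v. h (cls f (\<psi> v)) = cls g (var v)"
    by blast
  have h\<psi>: "cls g (subst \<phi> (subst \<psi> q)) = cls g q" for q
  proof (induction q rule: free_poly_induct)
    case (var v)
    show ?case using \<psi>[of v] by (simp add: h\<phi> subst.ev_simps)
  next
    case (add p q)
    then show ?case by (simp add: subst.ev_simps flip: presented_algebra_simps(3))
  next
    case (mult p q)
    then show ?case by (simp add: subst.ev_simps flip: presented_algebra_simps(2))
  qed (simp add: subst.ev_simps)
  have inj: "cls f p = cls f q" if "cls g (subst \<phi> p) = cls g (subst \<phi> q)" for p q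
    using bij that by (auto simp: bij_betw_def inj_on_def simp flip: h\<phi>)
  show ?thesis
  proof
    have "cls f f = cls f 0"
      by (simp add: cls_eq_iff rel_ideal_gen)
    then have "cls g (subst \<phi> f) = cls g 0"
      using h\<phi>[of f] h\<phi>[of 0] by (simp add: subst.ev_simps)
    then show "subst \<phi> f \<in> rel_ideal g" by (simp add: cls_eq_iff)
    have "cls g (subst \<phi> (subst \<psi> g)) = cls g (subst \<phi> 0)"
      by (simp add: h\<psi>) (simp add: cls_eq_iff rel_ideal_gen subst.ev_simps)
    from inj[OF this] show "subst \<psi> g \<in> rel_ideal f" by (simp add: cls_eq_iff)
    show "subst \<phi> (\<psi> v) - var v \<in> rel_ideal g" for v
      using h\<psi>[of "var v"] by (simp add: cls_eq_iff subst.ev_simps)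
    have "cls g (subst \<phi> (subst \<psi> (\<phi> v))) = cls g (subst \<phi> (var v))" for v
      by (simp add: h\<psi> subst.ev_simps)
    from inj[OF this] show "subst \<psi> (\<phi> v) - var v \<in> rel_ideal f" for v
      by (simp add: cls_eq_iff)
  qed
qed

lemma (in central_scalars) ev_rel_ideal:
  assumes "p \<in> rel_ideal f" "ev s g f = 0"
  shows "ev s g p = 0"
proof -
  have "rel_ideal f \<subseteq> {p. ev s g p = 0}"
    by (rule rel_ideal_minimal) (simp_all add: ev_simps assms(2))
  with assms(1) show ?thesis by blast
qed

section \<open>One-dimensional representations and their extensions\<close>

text \<open>
  Upper triangular \<open>2 \<times> 2\<close> matrices. A representation by such matrices is an extension of two
  one-dimensional representations, and \<open>off\<close>, as a function on the algebra, is a derivation with respect to them.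
\<close>

datatype 'k tri = Tri (diag1: 'k) (off: 'k) (diag2: 'k)

instantiation tri :: (field) ring_1
begin

definition zero_tri :: "'a tri" where "0 = Tri 0 0 0"
definition one_tri :: "'a tri" where "1 = Tri 1 0 1"
definition plus_tri :: "'a tri \<Rightarrow> 'a tri \<Rightarrow> 'a tri"
  where "A + B = Tri (diag1 A + diag1 B) (off A + off B) (diag2 A + diag2 B)"
definition minus_tri :: "'a tri \<Rightarrow> 'a tri \<Rightarrow> 'a tri"
  where "A - B = Tri (diag1 A - diag1 B) (off A - off B) (diag2 A - diag2 B)"
definition uminus_tri :: "'a tri \<Rightarrow> 'a tri"
  where "- A = Tri (- diag1 A) (- off A) (- diag2 A)"
definition times_tri :: "'a tri \<Rightarrow> 'a tri \<Rightarrow> 'a tri"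
  where "A * B = Tri (diag1 A * diag1 B) (diag1 A * off B + off A * diag2 B) (diag2 A * diag2 B)"

instance
  by standard
    (simp_all add: zero_tri_def one_tri_def plus_tri_def minus_tri_def uminus_tri_def times_tri_def
      algebra_simps)

end

lemmas tri_defs = zero_tri_def one_tri_def plus_tri_def times_tri_def

interpretation pt: central_scalars "\<lambda>c. c"
  by unfold_locales simp_all

interpretation tri: central_scalars "\<lambda>c. Tri c 0 c"
  by unfold_locales (simp_all add: tri_defs mult.commute)

definition value_at :: "'k::field \<times> 'k \<Rightarrow> 'k free_poly \<Rightarrow> 'k"
  where "value_at P = ev (\<lambda>c. c) (case_gen (fst P) (snd P))"

text \<open>
  The upper triangular matrices that are substituted for \<open>x\<close> and \<open>y\<close> have off-diagonal entries \<open>s\<close> and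
  \<open>t\<close>; the points \<open>P\<close> and \<open>Q\<close> supply the two diagonals.
\<close>

definition tri_at :: "'k::field \<times> 'k \<Rightarrow> 'k \<times> 'k \<Rightarrow> 'k \<Rightarrow> 'k \<Rightarrow> 'k free_poly \<Rightarrow> 'k tri"
  where "tri_at P Q s t =
    ev (\<lambda>c. Tri c 0 c) (case_gen (Tri (fst P) s (fst Q)) (Tri (snd P) t (snd Q)))"

lemmas value_at_simps = pt.ev_simps[of "case_gen (fst P) (snd P)" for P, folded value_at_def]

lemmas tri_at_simps = tri.ev_simps[of
    "case_gen (Tri (fst P) s (fst Q)) (Tri (snd P) t (snd Q))" for P Q s t, folded tri_at_def]

lemma diag_tri_at:
  "diag1 (tri_at P Q s t p) = value_at P p" "diag2 (tri_at P Q s t p) = value_at Q p"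
proof -
  have "diag1 (tri_at P Q s t p) = value_at P p \<and> diag2 (tri_at P Q s t p) = value_at Q p"
  proof (induction p rule: free_poly_induct)
    case (var v)
    show ?case by (cases v) (simp_all add: value_at_simps tri_at_simps)
  qed (simp_all add: value_at_simps tri_at_simps, simp_all add: tri_defs)
  then show "diag1 (tri_at P Q s t p) = value_at P p" "diag2 (tri_at P Q s t p) = value_at Q p"
    by auto
qed

lemma off_tri_at_linear: "\<exists>u v. \<forall>s t. off (tri_at P Q s t p) = u * s + v * t"
proof (induction p rule: free_poly_induct)
  case (scalar c)
  show ?case by (intro exI[of _ 0]) (simp add: tri_at_simps)
next
  case (var v)
  show ?case
  proof (cases v)
    case X
    then show ?thesis by (intro exI[of _ 1] exI[of _ 0]) (simp add: tri_at_simps)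
  next
    case Y
    then show ?thesis by (intro exI[of _ 0] exI[of _ 1]) (simp add: tri_at_simps)
  qed
next
  case (add p q)
  then obtain u v u' v' where
    "\<And>s t. off (tri_at P Q s t p) = u * s + v * t" "\<And>s t. off (tri_at P Q s t q) = u' * s + v' * t"
    by blast
  then have "\<forall>s t. off (tri_at P Q s t (p + q)) = (u + u') * s + (v + v') * t"
    by (simp add: tri_at_simps) (simp add: plus_tri_def algebra_simps)
  then show ?case by blast
next
  case (mult p q)
  then obtain u v u' v' where
    "\<And>s t. off (tri_at P Q s t p) = u * s + v * t" "\<And>s t. off (tri_at P Q s t q) = u' * s + v' * t"
    by blast
  then have "\<forall>s t. off (tri_at P Q s t (p * q)) =
      (value_at P p * u' + u * value_at Q q) * s + (value_at P p * v' + v * value_at Q q) * t"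
    by (simp add: tri_at_simps) (simp add: times_tri_def diag_tri_at algebra_simps)
  then show ?case by blast
qed

definition pts :: "'k::field free_poly \<Rightarrow> ('k \<times> 'k) set"
  where "pts f = {P. value_at P f = 0}"

text \<open>
  For points \<open>P\<close> and \<open>Q\<close> of \<open>f\<close>, this says that the space of \<open>(P, Q)\<close>-derivations of the presented
  algebra has the largest dimension possible with two generators, namely two.
\<close>

definition linked :: "'k::field free_poly \<Rightarrow> 'k \<times> 'k \<Rightarrow> 'k \<times> 'k \<Rightarrow> bool"
  where "linked f P Q \<longleftrightarrow> (\<forall>s t. tri_at P Q s t f = 0)"

lemma linked_pts: "linked f P Q \<Longrightarrow> P \<in> pts f \<and> Q \<in> pts f"
  unfolding linked_def pts_def
  using diag_tri_at[of P Q 0 0 f] by (simp add: zero_tri_def)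

definition poly_map :: "(gen \<Rightarrow> 'k::field free_poly) \<Rightarrow> 'k \<times> 'k \<Rightarrow> 'k \<times> 'k"
  where "poly_map \<phi> P = (value_at P (\<phi> X), value_at P (\<phi> Y))"

lemma value_at_subst: "value_at P (subst \<phi> p) = value_at (poly_map \<phi> P) p"
  unfolding value_at_def pt.ev_subst poly_map_def
  by (rule arg_cong[of _ _ "\<lambda>g. ev _ g p"], rule ext) (simp split: gen.split)

lemma tri_at_subst:
  "tri_at P Q s t (subst \<phi> p) = tri_at (poly_map \<phi> P) (poly_map \<phi> Q)
    (off (tri_at P Q s t (\<phi> X))) (off (tri_at P Q s t (\<phi> Y))) p"
proof -
  have "tri_at P Q s t q = Tri (value_at P q) (off (tri_at P Q s t q)) (value_at Q q)" for q
    using diag_tri_at[of P Q s t q] tri.collapse by metis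
  then have "(\<lambda>v. tri_at P Q s t (\<phi> v)) =
      case_gen (Tri (value_at P (\<phi> X)) (off (tri_at P Q s t (\<phi> X))) (value_at Q (\<phi> X)))
        (Tri (value_at P (\<phi> Y)) (off (tri_at P Q s t (\<phi> Y))) (value_at Q (\<phi> Y)))"
    by (intro ext) (simp split: gen.split)
  then show ?thesis
    by (simp add: tri_at_def tri.ev_subst poly_map_def)
qed

text \<open>
  The map \<open>poly_map \<phi>\<close> embeds the points of \<open>f\<close> with their links into those of \<open>g\<close>, with the
  polynomial left inverse \<open>poly_map \<psi>\<close>. An isomorphism gives such embeddings in both directions,
  with \<open>\<phi>\<close> and \<open>\<psi>\<close> exchanged.
\<close>

definition point_embedding ::
    "'k::field free_poly \<Rightarrow> 'k free_poly \<Rightarrow> (gen \<Rightarrow> 'k free_poly) \<Rightarrow> (gen \<Rightarrow> 'k free_poly) \<Rightarrow> bool"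
  where "point_embedding f g \<phi> \<psi> \<longleftrightarrow>
    (\<forall>P\<in>pts f. poly_map \<phi> P \<in> pts g \<and> poly_map \<psi> (poly_map \<phi> P) = P) \<and>
    (\<forall>P Q. linked f P Q \<longrightarrow> linked g (poly_map \<phi> P) (poly_map \<phi> Q))"

text \<open>
  For the matrices \<open>L\<close> with rows \<open>(a1, b1)\<close>, \<open>(a2, b2)\<close> and \<open>M\<close> with rows \<open>(c1, d1)\<close>, \<open>(c2, d2)\<close>, the
  claim is that \<open>M L = 1\<close> implies \<open>L M = 1\<close>.
\<close>

lemma left_inverse_2x2_imp_right_inverse:
  fixes a1 :: "'k::field"
  assumes "c1 * a1 + d1 * a2 = 1" "c2 * a1 + d2 * a2 = 0" "c1 * b1 + d1 * b2 = 0" "c2 * b1 + d2 * b2 = 1"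
  shows "a1 * c1 + b1 * c2 = 1 \<and> a1 * d1 + b1 * d2 = 0 \<and> a2 * c1 + b2 * c2 = 0 \<and> a2 * d1 + b2 * d2 = 1"
proof -
  define D where "D = a1 * b2 - b1 * a2"
  have "D * (c1 * d2 - d1 * c2)
      = (c1 * a1 + d1 * a2) * (c2 * b1 + d2 * b2) - (c2 * a1 + d2 * a2) * (c1 * b1 + d1 * b2)"
    by (simp add: D_def algebra_simps)
  then have det: "D * (c1 * d2 - d1 * c2) = 1" by (simp only: assms mult_1 mult_zero_left diff_zero)
  have "D * d2 = a1 * (c2 * b1 + d2 * b2) - b1 * (c2 * a1 + d2 * a2)"
    "D * d1 = a1 * (c1 * b1 + d1 * b2) - b1 * (c1 * a1 + d1 * a2)"
    "D * c2 = b2 * (c2 * a1 + d2 * a2) - a2 * (c2 * b1 + d2 * b2)"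
    "D * c1 = b2 * (c1 * a1 + d1 * a2) - a2 * (c1 * b1 + d1 * b2)"
    by (simp_all add: D_def algebra_simps)
  then have "a1 = D * d2" "b1 = - (D * d1)" "a2 = - (D * c2)" "b2 = D * c1"
    by (simp_all only: assms mult_1_right mult_zero_right diff_zero diff_0 minus_minus)
  then show ?thesis using det by (simp add: algebra_simps)
qed

text \<open>
  Representations are pulled back along the lifted substitution. The delicate point is that links
  are preserved: pulling back acts on the off-diagonal entries \<open>(s, t)\<close> by a \<open>2 \<times> 2\<close> matrix \<open>L\<close>, since these
  entries depend linearly on \<open>(s, t)\<close>. If \<open>P\<close> and \<open>Q\<close> are linked, then every \<open>(s, t)\<close> gives a
  representation for \<open>f\<close>, so the substitution \<open>\<psi>\<close> provides a left inverse of \<open>L\<close>. Thus \<open>L\<close> is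
  surjective, and every choice of off-diagonal entries over the image points is a pullback, hence
  satisfies \<open>g\<close>.
\<close>

lemma point_embedding_of_lift:
  fixes f g :: "'k::field free_poly"
  assumes \<phi>: "subst \<phi> g \<in> rel_ideal f"
    and \<psi>\<phi>: "\<And>v. subst \<phi> (\<psi> v) - var v \<in> rel_ideal f"
  shows "point_embedding f g \<phi> \<psi>"
  unfolding point_embedding_def
proof (intro conjI ballI allI impI)
  have kill: "value_at P p = 0" if "P \<in> pts f" "p \<in> rel_ideal f" for P p
    using that pt.ev_rel_ideal[OF that(2), of "case_gen (fst P) (snd P)"]
    by (simp add: pts_def value_at_def)
  fix P assume P: "P \<in> pts f"
  show "poly_map \<phi> P \<in> pts g"
    using kill[OF P \<phi>] by (simp add: pts_def value_at_subst)
  have "value_at (poly_map \<phi> P) (\<psi> v) = value_at P (var v)" for v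
    using kill[OF P \<psi>\<phi>[of v]] by (simp add: value_at_simps value_at_subst)
  then show "poly_map \<psi> (poly_map \<phi> P) = P"
    by (subst poly_map_def) (simp add: value_at_simps)
next
  fix P Q assume PQ: "linked f P Q"
  have kill: "tri_at P Q s t p = 0" if "p \<in> rel_ideal f" for s t p
    using PQ tri.ev_rel_ideal[OF that] by (simp add: linked_def tri_at_def)
  let ?P = "poly_map \<phi> P" and ?Q = "poly_map \<phi> Q"
  let ?L = "\<lambda>v s t. off (tri_at P Q s t (\<phi> v))" and ?M = "\<lambda>v s t. off (tri_at ?P ?Q s t (\<psi> v))"
  obtain a1 b1 a2 b2 where L: "\<And>s t. ?L X s t = a1 * s + b1 * t" "\<And>s t. ?L Y s t = a2 * s + b2 * t"
    using off_tri_at_linear[of P Q] by metis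
  obtain c1 d1 c2 d2 where M: "\<And>s t. ?M X s t = c1 * s + d1 * t" "\<And>s t. ?M Y s t = c2 * s + d2 * t"
    using off_tri_at_linear[of ?P ?Q] by metis
  have comp: "?M v (?L X s t) (?L Y s t) = off (tri_at P Q s t (var v))" for v s t
  proof -
    have "tri_at P Q s t (subst \<phi> (\<psi> v)) = tri_at P Q s t (var v)"
      using kill[OF \<psi>\<phi>[of v]] by (simp add: tri_at_simps)
    then show ?thesis by (simp add: tri_at_subst)
  qed
  have inv: "c1 * a1 + d1 * a2 = 1" "c2 * a1 + d2 * a2 = 0" "c1 * b1 + d1 * b2 = 0" "c2 * b1 + d2 * b2 = 1"
    using comp[of 1 0 X] comp[of 1 0 Y] comp[of 0 1 X] comp[of 0 1 Y] by (simp_all add: L M tri_at_simps)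
  then have inv': "a1 * c1 + b1 * c2 = 1" "a1 * d1 + b1 * d2 = 0" "a2 * c1 + b2 * c2 = 0" "a2 * d1 + b2 * d2 = 1"
    using left_inverse_2x2_imp_right_inverse[OF inv] by simp_all
  have "tri_at ?P ?Q s t g = 0" for s t
  proof -
    let ?s = "c1 * s + d1 * t" and ?t = "c2 * s + d2 * t"
    have "?L X ?s ?t = (a1 * c1 + b1 * c2) * s + (a1 * d1 + b1 * d2) * t"
      "?L Y ?s ?t = (a2 * c1 + b2 * c2) * s + (a2 * d1 + b2 * d2) * t"
      by (simp_all add: L algebra_simps)
    then have "?L X ?s ?t = s" "?L Y ?s ?t = t"
      by (simp_all add: inv')
    then show ?thesis
      using kill[OF \<phi>, of ?s ?t] by (simp add: tri_at_subst)
  qed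
  then show "linked g ?P ?Q" by (simp add: linked_def)
qed

lemma isomorphic_point_embeddings:
  assumes "presented_algebra f \<cong>\<^sub>a presented_algebra g"
  obtains \<phi> \<psi> where "point_embedding f g \<phi> \<psi>" "point_embedding g f \<psi> \<phi>"
proof -
  from assms obtain \<phi> \<psi> where "subst \<phi> f \<in> rel_ideal g" "subst \<psi> g \<in> rel_ideal f"
    "\<And>v. subst \<psi> (\<phi> v) - var v \<in> rel_ideal f" "\<And>v. subst \<phi> (\<psi> v) - var v \<in> rel_ideal g"
    by (rule isomorphic_lift) blast
  then show ?thesis using that point_embedding_of_lift by blast
qed

lemma value_at_polynomial_curve: "\<exists>U. \<forall>t. value_at (poly a t, poly b t) p = poly U t"
proof (induction p rule: free_poly_induct)
  case (scalar c)
  show ?case by (intro exI[of _ "[:c:]"]) (simp add: value_at_simps)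
next
  case (var v)
  show ?case by (intro exI[of _ "case_gen a b v"]) (simp add: value_at_simps split: gen.split)
next
  case (add p q)
  then obtain U V where "\<And>t. value_at (poly a t, poly b t) p = poly U t"
    "\<And>t. value_at (poly a t, poly b t) q = poly V t" by blast
  then show ?case by (intro exI[of _ "U + V"]) (simp add: value_at_simps)
next
  case (mult p q)
  then obtain U V where "\<And>t. value_at (poly a t, poly b t) p = poly U t"
    "\<And>t. value_at (poly a t, poly b t) q = poly V t" by blast
  then show ?case by (intro exI[of _ "U * V"]) (simp add: value_at_simps)
qed

text \<open>
  Along the hyperbola \<open>xy = c\<close>, parametrised by \<open>x = t\<close>, every polynomial is a Laurent polynomial in \<open>t\<close>.
\<close>

lemma value_at_hyperbola: "\<exists>U n. \<forall>t. t \<noteq> 0 \<longrightarrow> value_at (t, c / t) p * t ^ n = poly U t"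
proof (induction p rule: free_poly_induct)
  case (scalar d)
  show ?case by (intro exI[of _ "[:d:]"] exI[of _ 0]) (simp add: value_at_simps)
next
  case (var v)
  show ?case
  proof (cases v)
    case X
    then show ?thesis by (intro exI[of _ "[:0, 1:]"] exI[of _ 0]) (simp add: value_at_simps)
  next
    case Y
    then show ?thesis by (intro exI[of _ "[:c:]"] exI[of _ 1]) (simp add: value_at_simps)
  qed
next
  case (add p q)
  obtain U m where U: "t \<noteq> 0 \<Longrightarrow> value_at (t, c / t) p * t ^ m = poly U t" for t
    using add.IH(1) by blast
  obtain V n where V: "t \<noteq> 0 \<Longrightarrow> value_at (t, c / t) q * t ^ n = poly V t" for t
    using add.IH(2) by blast
  have "value_at (t, c / t) (p + q) * t ^ (m + n) = poly (U * monom 1 n + V * monom 1 m) t"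
    if "t \<noteq> 0" for t
  proof -
    have "value_at (t, c / t) (p + q) * t ^ (m + n) =
        (value_at (t, c / t) p * t ^ m) * t ^ n + (value_at (t, c / t) q * t ^ n) * t ^ m"
      by (simp add: value_at_simps power_add algebra_simps)
    then show ?thesis by (simp add: U[OF that] V[OF that] poly_monom)
  qed
  then show ?case by blast
next
  case (mult p q)
  obtain U m where U: "t \<noteq> 0 \<Longrightarrow> value_at (t, c / t) p * t ^ m = poly U t" for t
    using mult.IH(1) by blast
  obtain V n where V: "t \<noteq> 0 \<Longrightarrow> value_at (t, c / t) q * t ^ n = poly V t" for t
    using mult.IH(2) by blast
  have "value_at (t, c / t) (p * q) * t ^ (m + n) = poly (U * V) t" if "t \<noteq> 0" for t
  proof -
    have "value_at (t, c / t) (p * q) * t ^ (m + n) =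
        (value_at (t, c / t) p * t ^ m) * (value_at (t, c / t) q * t ^ n)"
      by (simp add: value_at_simps power_add algebra_simps)
    then show ?thesis by (simp add: U[OF that] V[OF that])
  qed
  then show ?case by blast
qed

section \<open>Polynomial curves on lines and hyperbolas\<close>

lemma nonvanishing_poly_constant:
  fixes U :: "'k::alg_closed_field poly"
  assumes "\<And>t. poly U t \<noteq> 0"
  obtains c where "U = [:c:]"
  using alg_closed_imp_poly_has_root[of U] assms degree_eq_zeroE by (metis neq0_conv)

text \<open>
  Degrees multiply under composition, so \<open>U\<close> has degree one.
\<close>

lemma poly_left_inverse_affine:
  fixes U V :: "'k::field_char_0 poly"
  assumes "\<And>t. poly V (poly U t) = t"
  obtains a b where "a \<noteq> 0" "U = [:b, a:]"
proof -
  have "V \<circ>\<^sub>p U = [:0, 1:]"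
    by (rule poly_eq_poly_eq_iff[THEN iffD1]) (rule ext, simp add: poly_pcompose assms)
  then have "degree V * degree U = 1"
    using degree_pcompose[of V U] by simp
  then have "degree U = 1" by simp
  then have "U = [:coeff U 0, coeff U 1:]" "coeff U 1 \<noteq> 0"
    using coeff_eq_0[of U]
    by (auto intro!: poly_eqI simp: coeff_pCons split: nat.split) (metis leading_coeff_0_iff zero_neq_one degree_0 One_nat_def)
  then show ?thesis using that by blast
qed

text \<open>
  After splitting off the power of \<open>t\<close> that divides \<open>U\<close>, no root is left.
\<close>

lemma nonvanishing_off_zero_monomial:
  fixes U :: "'k::{alg_closed_field,field_char_0} poly"
  assumes "\<And>t. t \<noteq> 0 \<Longrightarrow> poly U t \<noteq> 0"
  shows "\<exists>a k. a \<noteq> 0 \<and> (\<forall>t. poly U t = a * t ^ k)"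
proof -
  have "U \<noteq> 0" using assms[of 1] by auto
  then obtain W where W: "U = [:- 0, 1:] ^ Polynomial.order 0 U * W" "\<not> [:- 0, 1:] dvd W"
    using order_decomp by blast
  have W': "poly U t = t ^ Polynomial.order 0 U * poly W t" for t
    by (subst W(1)) (simp add: poly_power)
  have "poly W t \<noteq> 0" for t
  proof (cases "t = 0")
    case True
    then show ?thesis using W(2) by (simp add: dvd_iff_poly_eq_0)
  next
    case False
    then show ?thesis using assms[of t] W' by auto
  qed
  then obtain c where "W = [:c:]" by (rule nonvanishing_poly_constant)
  moreover have "c \<noteq> 0" using calculation \<open>U \<noteq> 0\<close> W(1) by auto
  ultimately show ?thesis
    using W' by (intro exI[of _ c] exI[of _ "Polynomial.order 0 U"]) (simp add: mult.commute)
qed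

section \<open>Quadratic relations\<close>

definition quadratic :: "'k::field \<Rightarrow> 'k \<Rightarrow> 'k \<Rightarrow> 'k \<Rightarrow> 'k \<Rightarrow> 'k \<Rightarrow> 'k \<Rightarrow> 'k free_poly"
  where "quadratic a b c d \<alpha> \<beta> \<gamma> =
      scalar a * var X * var X + scalar b * var X * var Y
    + scalar c * var Y * var X + scalar d * var Y * var Y
    + scalar \<alpha> * var X + scalar \<beta> * var Y + scalar \<gamma>"

lemma mem_pts_quadratic:
  "(x, y) \<in> pts (quadratic a b c d \<alpha> \<beta> \<gamma>) \<longleftrightarrow>
    a * x * x + (b + c) * x * y + d * y * y + \<alpha> * x + \<beta> * y + \<gamma> = 0"
  by (simp add: pts_def quadratic_def value_at_simps algebra_simps)

text \<open>
  The off-diagonal entry of the value of \<open>f\<close> is linear in the off-diagonal entries \<open>s\<close> and \<open>t\<close>; the two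
  equations state that the coefficients of \<open>s\<close> and of \<open>t\<close> vanish.
\<close>

lemma linked_quadratic:
  fixes f :: "'k::field free_poly"
  assumes f: "f = quadratic a b c d \<alpha> \<beta> \<gamma>"
  shows "linked f (x1, y1) (x2, y2) \<longleftrightarrow> (x1, y1) \<in> pts f \<and> (x2, y2) \<in> pts f \<and>
    a * (x1 + x2) + b * y2 + c * y1 + \<alpha> = 0 \<and> b * x1 + c * x2 + d * (y1 + y2) + \<beta> = 0"
proof -
  let ?u = "a * (x1 + x2) + b * y2 + c * y1 + \<alpha>" and ?v = "b * x1 + c * x2 + d * (y1 + y2) + \<beta>"
  have off: "off (tri_at (x1, y1) (x2, y2) s t f) = ?u * s + ?v * t" for s t
    by (simp add: f quadratic_def tri_at_simps) (simp add: times_tri_def plus_tri_def algebra_simps)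
  have "tri_at P Q s t f = 0 \<longleftrightarrow> P \<in> pts f \<and> Q \<in> pts f \<and> off (tri_at P Q s t f) = 0" for P Q s t
    using diag_tri_at[of P Q s t f]
    by (cases "tri_at P Q s t f") (auto simp: zero_tri_def pts_def)
  then have "linked f (x1, y1) (x2, y2) \<longleftrightarrow> (x1, y1) \<in> pts f \<and> (x2, y2) \<in> pts f \<and>
      (\<forall>s t. ?u * s + ?v * t = 0)"
    by (simp only: linked_def off) blast
  moreover have "(\<forall>s t. ?u * s + ?v * t = 0) \<longleftrightarrow> ?u = 0 \<and> ?v = 0"
    by (metis add_0 add_0_right mult.right_neutral mult_zero_left mult_zero_right)
  ultimately show ?thesis by blast
qed

section \<open>Invariants of the link relation\<close>

definition no_points :: "'k::field free_poly \<Rightarrow> bool"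
  where "no_points f \<longleftrightarrow> pts f = {}"

definition no_links :: "'k::field free_poly \<Rightarrow> bool"
  where "no_links f \<longleftrightarrow> (\<forall>P Q. \<not> linked f P Q)"

definition functional_links :: "'k::field free_poly \<Rightarrow> bool"
  where "functional_links f \<longleftrightarrow> (\<forall>P Q R. linked f P Q \<longrightarrow> linked f P R \<longrightarrow> Q = R)"

definition symmetric_links :: "'k::field free_poly \<Rightarrow> bool"
  where "symmetric_links f \<longleftrightarrow> (\<forall>P Q. linked f P Q \<longrightarrow> linked f Q P)"

definition all_self_linked :: "'k::field free_poly \<Rightarrow> bool"
  where "all_self_linked f \<longleftrightarrow> (\<forall>P\<in>pts f. linked f P P)"

definition some_self_linked :: "'k::field free_poly \<Rightarrow> bool"
  where "some_self_linked f \<longleftrightarrow> (\<exists>P. linked f P P)"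

text \<open>
  All six properties only mention points and links, so they transport along the bijection of
  points.
\<close>

lemma point_embedding_invariants:
  assumes "point_embedding f g \<phi> \<psi>" "point_embedding g f \<psi> \<phi>"
  shows "no_points f = no_points g" "no_links f = no_links g"
    "functional_links f = functional_links g" "symmetric_links f = symmetric_links g"
    "all_self_linked f = all_self_linked g" "some_self_linked f = some_self_linked g"
proof -
  have one: "(no_points g \<longrightarrow> no_points f) \<and> (no_links g \<longrightarrow> no_links f) \<and>
      (functional_links g \<longrightarrow> functional_links f) \<and> (symmetric_links g \<longrightarrow> symmetric_links f) \<and>
      (all_self_linked g \<longrightarrow> all_self_linked f) \<and> (some_self_linked f \<longrightarrow> some_self_linked g)"
    if 1: "point_embedding f g \<phi> \<psi>" and 2: "point_embedding g f \<psi> \<phi>"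
    for f g :: "'a free_poly" and \<phi> \<psi>
  proof -
    have pts: "poly_map \<phi> P \<in> pts g" "poly_map \<psi> (poly_map \<phi> P) = P" if "P \<in> pts f" for P
      using 1 that unfolding point_embedding_def by blast+
    have ln: "linked g (poly_map \<phi> P) (poly_map \<phi> Q)" if "linked f P Q" for P Q
      using 1 that unfolding point_embedding_def by blast
    have ln': "linked f P Q"
      if "linked g (poly_map \<phi> P) (poly_map \<phi> Q)" "P \<in> pts f" "Q \<in> pts f" for P Q
    proof -
      have "linked f (poly_map \<psi> (poly_map \<phi> P)) (poly_map \<psi> (poly_map \<phi> Q))"
        using 2 that(1) unfolding point_embedding_def by blast
      then show ?thesis by (simp add: pts that)
    qed
    have "functional_links f" if "functional_links g"
      unfolding functional_links_def
    proof (intro allI impI)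
      fix P Q R assume "linked f P Q" "linked f P R"
      moreover from this have "poly_map \<phi> Q = poly_map \<phi> R"
        using that ln unfolding functional_links_def by blast
      ultimately show "Q = R" using pts(2) linked_pts by metis
    qed
    moreover have "symmetric_links f" if "symmetric_links g"
      using that ln ln' linked_pts unfolding symmetric_links_def by blast
    ultimately show ?thesis
      using pts ln ln' unfolding no_points_def no_links_def all_self_linked_def some_self_linked_def
      by blast
  qed
  from one[OF assms] one[OF assms(2,1)] show "no_points f = no_points g" "no_links f = no_links g"
    "functional_links f = functional_links g" "symmetric_links f = symmetric_links g"
    "all_self_linked f = all_self_linked g" "some_self_linked f = some_self_linked g"
    by blast+
qed

section \<open>Points and links of the normal forms\<close>

definition q_form :: "'k::field \<Rightarrow> 'k \<Rightarrow> 'k free_poly"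
  where "q_form q e = quadratic 0 1 (- q) 0 0 0 e"

definition jordan_form :: "'k::field \<Rightarrow> 'k free_poly"
  where "jordan_form e = quadratic 0 (- 1) 1 1 0 0 e"

definition square_form :: "'k::field \<Rightarrow> 'k free_poly"
  where "square_form e = quadratic 0 0 0 1 0 0 e"

definition parabola_form :: "'k::field free_poly"
  where "parabola_form = quadratic 0 0 0 1 1 0 0"

lemma pts_forms:
  "(x, y) \<in> pts (q_form q e) \<longleftrightarrow> (1 - q) * x * y + e = 0"
  "(x, y) \<in> pts (jordan_form e) \<longleftrightarrow> y * y + e = 0"
  "(x, y) \<in> pts (square_form e) \<longleftrightarrow> y * y + e = 0"
  "(x, y) \<in> pts parabola_form \<longleftrightarrow> y * y + x = 0"
  by (simp_all add: q_form_def jordan_form_def square_form_def parabola_form_def mem_pts_quadratic)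

lemma linked_forms:
  fixes q e :: "'k::field"
  shows "linked (q_form q e) (x1, y1) (x2, y2) \<longleftrightarrow> (x1, y1) \<in> pts (q_form q e) \<and>
    (x2, y2) \<in> pts (q_form q e) \<and> y2 = q * y1 \<and> x1 = q * x2"
  "linked (jordan_form e) (x1, y1) (x2, y2) \<longleftrightarrow> (x1, y1) \<in> pts (jordan_form e) \<and>
    (x2, y2) \<in> pts (jordan_form e) \<and> y2 = y1 \<and> x1 = x2 + (y1 + y2)"
  "linked (square_form e) (x1, y1) (x2, y2) \<longleftrightarrow> (x1, y1) \<in> pts (square_form e) \<and>
    (x2, y2) \<in> pts (square_form e) \<and> y1 + y2 = 0"
  "\<not> linked (parabola_form :: 'k free_poly) P Q"
proof -
  show "linked (q_form q e) (x1, y1) (x2, y2) \<longleftrightarrow> (x1, y1) \<in> pts (q_form q e) \<and>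
      (x2, y2) \<in> pts (q_form q e) \<and> y2 = q * y1 \<and> x1 = q * x2"
    by (simp add: linked_quadratic[OF q_form_def])
  show "linked (jordan_form e) (x1, y1) (x2, y2) \<longleftrightarrow> (x1, y1) \<in> pts (jordan_form e) \<and>
      (x2, y2) \<in> pts (jordan_form e) \<and> y2 = y1 \<and> x1 = x2 + (y1 + y2)"
  proof -
    have "0 * (x1 + x2) + - 1 * y2 + 1 * y1 + 0 = y1 - y2" by simp
    then have "0 * (x1 + x2) + - 1 * y2 + 1 * y1 + 0 = 0 \<longleftrightarrow> y2 = y1" by auto
    moreover have "- 1 * x1 + 1 * x2 + 1 * (y1 + y2) + 0 = x2 + (y1 + y2) - x1" by simp
    then have "- 1 * x1 + 1 * x2 + 1 * (y1 + y2) + 0 = 0 \<longleftrightarrow> x1 = x2 + (y1 + y2)"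
      by (metis right_minus_eq)
    ultimately show ?thesis by (simp only: linked_quadratic[OF jordan_form_def])
  qed
  show "linked (square_form e) (x1, y1) (x2, y2) \<longleftrightarrow> (x1, y1) \<in> pts (square_form e) \<and>
      (x2, y2) \<in> pts (square_form e) \<and> y1 + y2 = 0"
    by (simp add: linked_quadratic[OF square_form_def])
  show "\<not> linked (parabola_form :: 'k free_poly) P Q"
    by (cases P; cases Q) (simp add: linked_quadratic[OF parabola_form_def])
qed

lemma invariants_q_form:
  fixes q :: "'k::field_char_0"
  shows "\<not> no_points (q_form q 0)" "\<not> no_links (q_form q 0)"
    "functional_links (q_form q 0) \<longleftrightarrow> q \<noteq> 0" "q = 0 \<Longrightarrow> \<not> symmetric_links (q_form q 0)"
    "all_self_linked (q_form q 0) \<longleftrightarrow> q = 1" "some_self_linked (q_form q 0)"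
proof -
  have 0: "linked (q_form q 0) (0, 0) (0, 0)" by (simp add: linked_forms pts_forms)
  then show "\<not> no_links (q_form q 0)" "some_self_linked (q_form q 0)" "\<not> no_points (q_form q 0)"
    unfolding no_links_def some_self_linked_def no_points_def using linked_pts by blast+
  show "functional_links (q_form q 0) \<longleftrightarrow> q \<noteq> 0"
  proof
    assume fn: "functional_links (q_form q 0)"
    have "q = 0 \<Longrightarrow> linked (q_form q 0) (0, 0) (1, 0)" by (simp add: linked_forms pts_forms)
    with fn 0 show "q \<noteq> 0" unfolding functional_links_def by (metis Pair_inject zero_neq_one)
  qed (auto simp: functional_links_def linked_forms)
  show "\<not> symmetric_links (q_form q 0)" if "q = 0"
  proof -
    have "linked (q_form q 0) (0, 1) (1, 0)" "\<not> linked (q_form q 0) (1, 0) (0, 1)"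
      using that by (simp_all add: linked_forms pts_forms)
    then show ?thesis unfolding symmetric_links_def by blast
  qed
  show "all_self_linked (q_form q 0) \<longleftrightarrow> q = 1"
  proof
    assume "all_self_linked (q_form q 0)"
    moreover have "(1, 0) \<in> pts (q_form q 0)" by (simp add: pts_forms)
    ultimately have "linked (q_form q 0) (1, 0) (1, 0)" unfolding all_self_linked_def by blast
    then show "q = 1" by (simp add: linked_forms)
  qed (auto simp: all_self_linked_def linked_forms)
qed

lemma invariants_q_form_1:
  fixes q :: "'k::field_char_0"
  shows "no_points (q_form q 1) \<longleftrightarrow> q = 1" "no_links (q_form q 1) \<longleftrightarrow> q = 0 \<or> q = 1"
    "functional_links (q_form q 1)" "all_self_linked (q_form q 1) \<longleftrightarrow> q = 1"
    "\<not> some_self_linked (q_form q 1)"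
proof -
  have pt: "(x, 1 / ((q - 1) * x)) \<in> pts (q_form q 1)" if "q \<noteq> 1" "x \<noteq> 0" for x
    using that by (simp add: pts_forms divide_simps) algebra
  have no_pt: "P \<notin> pts (q_form q 1)" if "q = 1" for P
    using that by (cases P) (simp add: pts_forms)
  show np: "no_points (q_form q 1) \<longleftrightarrow> q = 1"
    unfolding no_points_def using no_pt pt[of 1] by auto
  have "linked (q_form q 1) (q, 1 / ((q - 1) * q)) (1, 1 / ((q - 1) * 1))" if "q \<noteq> 0" "q \<noteq> 1"
    using that pt[of q] pt[of 1] by (simp add: linked_forms)
  moreover have "\<not> linked (q_form q 1) P Q" if "q = 0" for P Q
    using that by (cases P; cases Q) (auto simp: linked_forms pts_forms)
  moreover have "\<not> linked (q_form q 1) P Q" if "q = 1" for P Q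
    using that no_pt linked_pts by blast
  ultimately show "no_links (q_form q 1) \<longleftrightarrow> q = 0 \<or> q = 1"
    unfolding no_links_def by blast
  show "functional_links (q_form q 1)"
    unfolding functional_links_def
  proof (intro allI impI)
    fix P Q R assume "linked (q_form q 1) P Q" "linked (q_form q 1) P R"
    then show "Q = R"
      by (cases P; cases Q; cases R; cases "q = 0") (auto simp: linked_forms pts_forms)
  qed
  have no_self: "\<not> linked (q_form q 1) P P" for P
  proof
    assume "linked (q_form q 1) P P"
    moreover obtain x y where "P = (x, y)" by (cases P)
    ultimately have "(1 - q) * x * y + 1 = 0" "x = q * x"
      by (auto simp: linked_forms pts_forms)
    moreover from this(2) have "(1 - q) * x = 0" by (simp add: left_diff_distrib)
    ultimately show False by simp
  qed
  then show "\<not> some_self_linked (q_form q 1)" unfolding some_self_linked_def by blast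
  show "all_self_linked (q_form q 1) \<longleftrightarrow> q = 1"
    using no_self np unfolding all_self_linked_def no_points_def by blast
qed

lemma square_root_of_minus:
  fixes e :: "'k::alg_closed_field"
  obtains r where "r * r + e = 0"
  using nth_root_exists[of 2 "- e"] by (metis power2_eq_square pos2 add.left_inverse)

lemma invariants_jordan_form:
  fixes e :: "'k::{alg_closed_field,field_char_0}"
  shows "\<not> no_points (jordan_form e)" "\<not> no_links (jordan_form e)"
    "functional_links (jordan_form e)"
    "all_self_linked (jordan_form e) \<longleftrightarrow> e = 0" "some_self_linked (jordan_form e) \<longleftrightarrow> e = 0"
proof -
  obtain r where r: "r * r + e = 0" by (rule square_root_of_minus)
  have l: "linked (jordan_form e) (2 * r, r) (0, r)"
    using r by (simp add: linked_forms pts_forms)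
  then show "\<not> no_links (jordan_form e)" "\<not> no_points (jordan_form e)"
    unfolding no_links_def no_points_def using linked_pts by blast+
  show "functional_links (jordan_form e)"
    by (auto simp: functional_links_def linked_forms)
  have self: "linked (jordan_form e) (x, y) (x, y) \<longleftrightarrow> e = 0 \<and> (x, y) \<in> pts (jordan_form e)" for x y
    by (auto simp: linked_forms pts_forms)
  show "all_self_linked (jordan_form e) \<longleftrightarrow> e = 0"
    using l linked_pts[OF l] self unfolding all_self_linked_def by (metis surj_pair)
  show "some_self_linked (jordan_form e) \<longleftrightarrow> e = 0"
    using l linked_pts[OF l] self unfolding some_self_linked_def by (metis surj_pair)
qed

lemma invariants_square_form:
  fixes e :: "'k::{alg_closed_field,field_char_0}"
  shows "\<not> no_points (square_form e)" "\<not> no_links (square_form e)"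
    "\<not> functional_links (square_form e)" "symmetric_links (square_form e)"
    "all_self_linked (square_form e) \<longleftrightarrow> e = 0"
proof -
  obtain r where r: "r * r + e = 0" by (rule square_root_of_minus)
  have l: "linked (square_form e) (x, r) (x', - r)" for x x'
    using r by (simp add: linked_forms pts_forms)
  then show "\<not> no_links (square_form e)" "\<not> no_points (square_form e)"
    unfolding no_links_def no_points_def using linked_pts by blast+
  show "\<not> functional_links (square_form e)"
    using l[of 0 0] l[of 0 1] unfolding functional_links_def by (metis Pair_inject zero_neq_one)
  show "symmetric_links (square_form e)"
    by (auto simp: symmetric_links_def linked_forms add.commute)
  have self: "linked (square_form e) (x, y) (x, y) \<longleftrightarrow> y = 0 \<and> (x, y) \<in> pts (square_form e)" for x y
    by (auto simp: linked_forms simp flip: mult_2)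
  show "all_self_linked (square_form e) \<longleftrightarrow> e = 0"
  proof
    assume "all_self_linked (square_form e)"
    moreover have "(0, r) \<in> pts (square_form e)" using r by (simp add: pts_forms)
    ultimately have "linked (square_form e) (0, r) (0, r)" unfolding all_self_linked_def by blast
    then show "e = 0" using self r by simp
  next
    assume "e = 0"
    then show "all_self_linked (square_form e)" unfolding all_self_linked_def using self
      by (auto simp: pts_forms)
  qed
qed

lemma invariants_parabola_form:
  "\<not> no_points (parabola_form :: 'k::field_char_0 free_poly)" "no_links (parabola_form :: 'k free_poly)"
  "functional_links (parabola_form :: 'k free_poly)"
proof -
  have "(0, 0) \<in> pts (parabola_form :: 'k free_poly)" by (simp add: pts_forms)
  then show "\<not> no_points (parabola_form :: 'k free_poly)" unfolding no_points_def by blast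
qed (simp_all add: no_links_def functional_links_def linked_forms)

section \<open>Polynomial maps between the conics\<close>

text \<open>
  The image of a polynomial curve on the hyperbola has nowhere vanishing coordinates. Over an
  algebraically closed field these are constant, so the embedding would identify different points of
  the curve.
\<close>

lemma no_line_on_hyperbola:
  fixes q :: "'k::{alg_closed_field,field_char_0}"
  assumes emb: "point_embedding f (q_form q 1) \<phi> \<psi>"
    and line: "\<And>t. (poly a t, poly b t) \<in> pts f" "poly a 0 \<noteq> poly a 1 \<or> poly b 0 \<noteq> poly b 1"
  shows False
proof -
  let ?P = "\<lambda>t. (poly a t, poly b t)"
  obtain U where U: "\<And>t. value_at (?P t) (\<phi> X) = poly U t"
    using value_at_polynomial_curve by blast
  obtain V where V: "\<And>t. value_at (?P t) (\<phi> Y) = poly V t"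
    using value_at_polynomial_curve by blast
  have UV: "(1 - q) * poly U t * poly V t + 1 = 0" for t
    using emb line(1)[of t] unfolding point_embedding_def
    by (auto simp: poly_map_def U V pts_forms)
  have "poly U t \<noteq> 0" for t using UV[of t] by auto
  then obtain c where c: "U = [:c:]" by (rule nonvanishing_poly_constant)
  have "poly V t \<noteq> 0" for t using UV[of t] by auto
  then obtain d where d: "V = [:d:]" by (rule nonvanishing_poly_constant)
  have "poly_map \<phi> (?P 0) = poly_map \<phi> (?P 1)"
    by (simp add: poly_map_def U V c d)
  then have "?P 0 = ?P 1"
    using emb line(1)[of 0] line(1)[of 1] unfolding point_embedding_def by metis
  with line(2) show False by simp
qed

text \<open>
  The two coordinate axes of the plane would be mapped injectively, by nonconstant polynomials, to the
  same line \<open>y = 0\<close>. Over an algebraically closed field both maps are onto, so their images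
  meet away from the image of the origin.
\<close>

lemma no_plane_on_line:
  fixes f :: "'k::{alg_closed_field,field_char_0} free_poly"
  assumes emb: "point_embedding f (jordan_form 0) \<phi> \<psi>" and plane: "pts f = UNIV"
  shows False
proof -
  let ?h = "\<lambda>P. value_at P (\<phi> X)"
  have "value_at P (\<phi> Y) = 0" for P
  proof -
    have "poly_map \<phi> P \<in> pts (jordan_form 0)"
      using emb plane unfolding point_embedding_def by blast
    then show ?thesis by (simp add: poly_map_def pts_forms)
  qed
  then have map: "poly_map \<phi> P = (?h P, 0)" for P
    by (simp add: poly_map_def)
  have inj: "P = Q" if "?h P = ?h Q" for P Q
    using emb plane that map unfolding point_embedding_def by (metis UNIV_I)
  obtain U where U: "\<And>t. ?h (t, 0) = poly U t"
    using value_at_polynomial_curve[of "[:0, 1:]" 0 "\<phi> X"] by auto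
  obtain V where V: "\<And>t. ?h (0, t) = poly V t"
    using value_at_polynomial_curve[of 0 "[:0, 1:]" "\<phi> X"] by auto
  have surj: "\<exists>t. poly W t = s" if "poly W 0 \<noteq> poly W 1" for W :: "'k poly" and s
  proof -
    have "degree (W - [:s:]) \<noteq> 0"
    proof
      assume "degree (W - [:s:]) = 0"
      then obtain c where "W - [:s:] = [:c:]" by (rule degree_eq_zeroE)
      then have "poly (W - [:s:]) 0 = poly (W - [:s:]) 1" by simp
      with that show False by simp
    qed
    then show ?thesis using alg_closed_imp_poly_has_root[of "W - [:s:]"] by auto
  qed
  have "poly U 0 \<noteq> poly U 1"
    using inj[of "(0, 0)" "(1, 0)"] unfolding U by auto
  moreover have "poly V 0 \<noteq> poly V 1"
    using inj[of "(0, 0)" "(0, 1)"] unfolding V by auto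
  ultimately obtain s t where "poly U s = ?h (0, 0) + 1" "poly V t = ?h (0, 0) + 1"
    using surj by meson
  then have "?h (s, 0) = ?h (0, 0) + 1" "(s, 0) = (0, t)"
    using inj[of "(s, 0)" "(0, t)"] by (simp_all add: U V)
  then show False by simp
qed

lemma nontrivial_root_of_unity:
  assumes "m \<ge> 2"
  obtains x :: "'k::{alg_closed_field,field_char_0}" where "x ^ m = 1" "x \<noteq> 1"
proof -
  have "\<exists>x::'k. (\<Sum>i\<le>m - 1. 1 * x ^ i) = 0"
    by (rule alg_closed) (use assms in auto)
  moreover have "{..m - 1} = {..<m}" using assms by auto
  ultimately obtain x :: 'k where x: "(\<Sum>i<m. x ^ i) = 0" by auto
  have "x ^ m - 1 = (x - 1) * (\<Sum>i<m. x ^ i)" by (rule power_diff_1_eq)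
  then have "x ^ m = 1" using x by simp
  moreover have "x \<noteq> 1" using x assms by auto
  ultimately show ?thesis by (rule that)
qed

text \<open>
  As \<open>r \<noteq> 1\<close>, the points of the target lie on the coordinate axes, where \<open>(rt, 0)\<close> is linked to \<open>(t, 0)\<close>
  and \<open>(0, t)\<close> to \<open>(0, rt)\<close>. The axis \<open>y = 0\<close> of the source, on which \<open>(qt, 0)\<close> is linked to \<open>(t, 0)\<close>, is
  mapped into one of these axes, by a polynomial with a polynomial left inverse, hence by an affine
  polynomial. Comparing the links gives \<open>q = r\<close> or \<open>q r = 1\<close>, according to which axis it is.
\<close>

lemma q_form_0_parameter:
  fixes q r :: "'k::{alg_closed_field,field_char_0}"
  assumes emb: "point_embedding (q_form q 0) (q_form r 0) \<phi> \<psi>" and r: "r \<noteq> 1"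
  shows "q = r \<or> q * r = 1"
proof -
  obtain U where U: "\<And>t. value_at (t, 0) (\<phi> X) = poly U t"
    using value_at_polynomial_curve[of "[:0, 1:]" 0 "\<phi> X"] by auto
  obtain V where V: "\<And>t. value_at (t, 0) (\<phi> Y) = poly V t"
    using value_at_polynomial_curve[of "[:0, 1:]" 0 "\<phi> Y"] by auto
  have map: "poly_map \<phi> (t, 0) = (poly U t, poly V t)" for t
    by (simp add: poly_map_def U V)
  have pt: "(t, 0) \<in> pts (q_form q 0)" for t by (simp add: pts_forms)
  have inv: "poly_map \<psi> (poly U t, poly V t) = (t, 0)" for t
    using emb pt[of t] unfolding point_embedding_def by (simp flip: map)
  have "poly_map \<phi> (t, 0) \<in> pts (q_form r 0)" for t
    using emb pt[of t] unfolding point_embedding_def by blast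
  then have "(1 - r) * poly U t * poly V t = 0" for t
    by (simp add: map pts_forms)
  then have "poly (U * V) t = poly 0 t" for t
    using r by simp
  then have "U * V = 0" using poly_eq_poly_eq_iff by blast
  have "linked (q_form q 0) (q * t, 0) (t, 0)" for t
    by (simp add: linked_forms pts_forms)
  then have ln: "linked (q_form r 0) (poly U (q * t), poly V (q * t)) (poly U t, poly V t)" for t
    using emb unfolding point_embedding_def by (simp flip: map)
  from \<open>U * V = 0\<close> consider "V = 0" | "U = 0" by auto
  then show ?thesis
  proof cases
    case 1
    obtain W where W: "\<And>s. value_at (s, 0) (\<psi> X) = poly W s"
      using value_at_polynomial_curve[of "[:0, 1:]" 0 "\<psi> X"] by auto
    have "poly W (poly U t) = t" for t
      using inv[of t] by (simp add: poly_map_def W 1)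
    then obtain a b where ab: "a \<noteq> 0" "U = [:b, a:]" by (rule poly_left_inverse_affine)
    have "poly U (q * t) = r * poly U t" for t
      using ln[of t] by (simp add: linked_forms)
    from this[of 0] this[of 1] have "b + q * a = r * (b + a)" "b = r * b"
      by (simp_all add: ab)
    then have "q * a = r * a" by (metis add_left_cancel distrib_left)
    with ab show ?thesis by simp
  next
    case 2
    obtain W where W: "\<And>s. value_at (0, s) (\<psi> X) = poly W s"
      using value_at_polynomial_curve[of 0 "[:0, 1:]" "\<psi> X"] by auto
    have "poly W (poly V t) = t" for t
      using inv[of t] by (simp add: poly_map_def W 2)
    then obtain a b where ab: "a \<noteq> 0" "V = [:b, a:]" by (rule poly_left_inverse_affine)
    have "poly V t = r * poly V (q * t)" for t
      using ln[of t] by (simp add: linked_forms)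
    from this[of 0] this[of 1] have "b + a = r * (b + q * a)" "b = r * b"
      by (simp_all add: ab)
    then have "a = r * (q * a)" by (metis add_left_cancel distrib_left)
    then have "(q * r) * a = 1 * a" by (simp add: mult_ac)
    with ab(1) show ?thesis using mult_right_cancel by blast
  qed
qed

text \<open>
  The \<open>x\<close>-coordinate of the image of \<open>(t, c/t)\<close> is a nowhere vanishing Laurent polynomial, hence of the form
  \<open>a t\<^sup>k / t\<^sup>n\<close>. Injectivity forces \<open>k - n = \<plusminus>1\<close>, since the field contains nontrivial roots of
  unity of every order at least two. As links multiply the parameter \<open>t\<close> by \<open>1/q\<close> on one side and by
  \<open>1/r\<close> on the other, \<open>r = q\<^sup>k\<^sup>-\<^sup>n\<close>.
\<close>

lemma q_form_1_parameter:
  fixes q r :: "'k::{alg_closed_field,field_char_0}"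
  assumes emb: "point_embedding (q_form q 1) (q_form r 1) \<phi> \<psi>" and q: "q \<noteq> 0" "q \<noteq> 1"
  shows "q = r \<or> q * r = 1"
proof -
  define c where "c = 1 / (q - 1)"
  obtain U n where Un: "\<And>t. t \<noteq> 0 \<Longrightarrow> value_at (t, c / t) (\<phi> X) * t ^ n = poly U t"
    using value_at_hyperbola by blast
  have pt: "(t, c / t) \<in> pts (q_form q 1)" if "t \<noteq> 0" for t
  proof -
    have "(1 - q) * t * (c / t) + 1 = (1 - q) * c + 1" using that by simp
    also have "\<dots> = 0" using q by (simp add: c_def divide_simps)
    finally show ?thesis by (simp add: pts_forms)
  qed
  let ?u = "\<lambda>t. value_at (t, c / t) (\<phi> X)" and ?v = "\<lambda>t. value_at (t, c / t) (\<phi> Y)"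
  have uv: "(1 - r) * ?u t * ?v t + 1 = 0" if "t \<noteq> 0" for t
  proof -
    have "poly_map \<phi> (t, c / t) \<in> pts (q_form r 1)"
      using emb pt[OF that] unfolding point_embedding_def by blast
    then show ?thesis by (simp add: poly_map_def pts_forms)
  qed
  then have u0: "?u t \<noteq> 0" if "t \<noteq> 0" for t using that by fastforce
  then have "poly U t \<noteq> 0" if "t \<noteq> 0" for t
    using Un[OF that] that by (metis mult_eq_0_iff power_eq_0_iff)
  then obtain a k where ak: "a \<noteq> 0" "\<And>t. poly U t = a * t ^ k"
    using nonvanishing_off_zero_monomial[of U] by blast
  have u: "?u t * t ^ n = a * t ^ k" if "t \<noteq> 0" for t
    using Un[OF that] ak by simp
  have inj: "s = t" if "s \<noteq> 0" "t \<noteq> 0" "?u s = ?u t" for s t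
  proof -
    have "(1 - r) * ?u s \<noteq> 0" using uv[OF that(1)] by auto
    moreover have "(1 - r) * ?u s * ?v s = (1 - r) * ?u s * ?v t"
      using uv[OF that(1)] uv[OF that(2)] that(3) by (metis add_right_cancel)
    ultimately have "?v s = ?v t" using mult_left_cancel by blast
    then have "poly_map \<phi> (s, c / s) = poly_map \<phi> (t, c / t)"
      by (simp add: poly_map_def that(3))
    then have "(s, c / s) = (t, c / t)"
      using emb pt[OF that(1)] pt[OF that(2)] unfolding point_embedding_def by metis
    then show ?thesis by simp
  qed
  have one: "x = 1" if "x \<noteq> 0" "x ^ k = x ^ n" for x :: 'k
  proof (rule inj)
    show "?u x = ?u 1" using u[OF that(1)] u[of 1] that by simp
  qed (use that in auto)
  have "linked (q_form q 1) (q * t, c / (q * t)) (t, c / t)" if "t \<noteq> 0" for t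
    using that q pt[of t] pt[of "q * t"] by (simp add: linked_forms)
  from this[of 1] have "linked (q_form r 1) (poly_map \<phi> (q, c / q)) (poly_map \<phi> (1, c / 1))"
    using emb unfolding point_embedding_def by simp
  then have "?u q = r * ?u 1" by (simp add: poly_map_def linked_forms)
  then have "q ^ k = r * q ^ n"
    using u[OF q(1)] u[of 1] ak(1) by (simp add: mult_ac)
  \<comment> \<open>one of the two truncated differences is zero, so this is the absolute difference\<close>
  define m where "m = (k - n) + (n - k)"
  have "\<not> m \<ge> 2"
  proof
    assume "m \<ge> 2"
    then obtain x :: 'k where x: "x ^ m = 1" "x \<noteq> 1" by (rule nontrivial_root_of_unity)
    have "x ^ k = x ^ n"
    proof (cases "n \<le> k")
      case True
      then have "k = n + m" by (simp add: m_def)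
      then show ?thesis using x by (simp add: power_add)
    next
      case False
      then have "n = k + m" by (simp add: m_def)
      then show ?thesis using x by (simp add: power_add)
    qed
    moreover have "x \<noteq> 0" using x \<open>m \<ge> 2\<close> by (auto simp: power_0_left)
    ultimately show False using one x by blast
  qed
  moreover have "m \<noteq> 0" using one[of 2] by (auto simp: m_def)
  ultimately consider "k = Suc n" | "n = Suc k" unfolding m_def by linarith
  then show ?thesis
    using \<open>q ^ k = r * q ^ n\<close> q by cases (auto simp: mult_ac)
qed

section \<open>Affine equivalence\<close>

definition affine :: "'k::field \<Rightarrow> 'k \<Rightarrow> 'k \<Rightarrow> 'k \<Rightarrow> 'k \<Rightarrow> 'k \<Rightarrow> gen \<Rightarrow> 'k free_poly"
  where "affine p q u r s v =
    case_gen (scalar p * var X + scalar q * var Y + scalar u) (scalar r * var X + scalar s * var Y + scalar v)"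

text \<open>
  The six parameters \<open>p, q, u, r, s, v\<close> of \<open>affine\<close> are the two upper rows of a matrix in
  \<open>\<P>\<^sub>3\<close>.
\<close>

definition aff_equiv :: "'k::field free_poly \<Rightarrow> 'k free_poly \<Rightarrow> bool"
  where "aff_equiv f g \<longleftrightarrow> (\<exists>p q u r s v k. p * s - q * r \<noteq> 0 \<and> k \<noteq> 0 \<and>
    f = scalar k * subst (affine p q u r s v) g)"

lemma var_scalar: "var v * scalar c = scalar c * var v"
  by (rule scalar_central[symmetric])

lemma var_scalar_left: "var v * (scalar c * z) = scalar c * (var v * z)"
  by (simp only: mult.assoc[symmetric] var_scalar)

lemma scalar_commute: "scalar a * scalar b = scalar b * scalar a"
  by (rule scalar_central)

lemma scalar_left_commute: "scalar a * (scalar b * z) = scalar b * (scalar a * z)"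
  by (simp only: mult.assoc[symmetric] scalar_commute)

text \<open>
  These rules move scalars to the front and sort them, while the order of the variables is kept.
\<close>

lemmas scalar_expand = distrib_left distrib_right scalar_add scalar_mult mult.assoc
  var_scalar var_scalar_left scalar_commute scalar_left_commute

lemma subst_affine_affine:
  "subst (affine p q u r s v) (affine p' q' u' r' s' v' w) =
    affine (p' * p + q' * r) (p' * q + q' * s) (p' * u + q' * v + u')
      (r' * p + s' * r) (r' * q + s' * s) (r' * u + s' * v + v') w"
  by (cases w) (simp_all add: affine_def subst.ev_simps scalar_expand add_ac)

lemma affine_identity: "affine 1 0 0 0 1 0 = var"
  by (rule ext) (simp add: affine_def split: gen.split)

lemma affine_inverse:
  assumes D: "p * s - q * r \<noteq> (0::'k::field)"
  obtains p' q' u' r' s' v' where "p' * s' - q' * r' \<noteq> 0"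
    "\<And>w. subst (affine p q u r s v) (affine p' q' u' r' s' v' w) = var w"
    "\<And>w. subst (affine p' q' u' r' s' v') (affine p q u r s v w) = var w"
proof -
  define D where "D = p * s - q * r"
  have [simp]: "D \<noteq> 0" using D by (simp add: D_def)
  let ?p = "s / D" and ?q = "- q / D" and ?r = "- r / D" and ?s = "p / D"
  let ?u = "(q * v - s * u) / D" and ?v = "(r * u - p * v) / D"
  have "?p * ?s - ?q * ?r = (p * s - q * r) / (D * D)"
    by (simp add: diff_divide_distrib mult.commute)
  then have "?p * ?s - ?q * ?r \<noteq> 0" by (simp flip: D_def)
  moreover have "subst (affine p q u r s v) (affine ?p ?q ?u ?r ?s ?v w) = var w" for w
  proof -
    have E: "?p * p + ?q * r = D / D" "?p * q + ?q * s = 0 / D" "?p * u + ?q * v + ?u = 0 / D"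
      "?r * p + ?s * r = 0 / D" "?r * q + ?s * s = D / D" "?r * u + ?s * v + ?v = 0 / D"
      by (simp_all add: D_def algebra_simps flip: add_divide_distrib diff_divide_distrib)
    show ?thesis unfolding subst_affine_affine E by (simp add: affine_identity)
  qed
  moreover have "subst (affine ?p ?q ?u ?r ?s ?v) (affine p q u r s v w) = var w" for w
  proof -
    have E: "p * ?p + q * ?r = D / D" "p * ?q + q * ?s = 0 / D" "r * ?p + s * ?r = 0 / D"
      "r * ?q + s * ?s = D / D"
      by (simp_all add: D_def algebra_simps flip: add_divide_distrib diff_divide_distrib)
    have F: "p * ?u + q * ?v + u = 0" "r * ?u + s * ?v + v = 0"
    proof -
      have "p * ?u + q * ?v = - u * (p * s - q * r) / D" "r * ?u + s * ?v = - v * (p * s - q * r) / D"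
        by (simp_all add: algebra_simps flip: add_divide_distrib diff_divide_distrib)
      then show "p * ?u + q * ?v + u = 0" "r * ?u + s * ?v + v = 0" by (simp_all flip: D_def)
    qed
    show ?thesis unfolding subst_affine_affine E F by (simp add: affine_identity)
  qed
  ultimately show ?thesis by (rule that)
qed

lemma aff_equiv_refl: "aff_equiv f f"
  unfolding aff_equiv_def
  by (rule exI[of _ 1], rule exI[of _ 0], rule exI[of _ 0], rule exI[of _ 0], rule exI[of _ 1],
      rule exI[of _ 0], rule exI[of _ 1]) (simp add: affine_identity subst_var)

lemma aff_equiv_sym:
  assumes "aff_equiv f g"
  shows "aff_equiv g f"
proof -
  obtain p q u r s v k where D: "p * s - q * r \<noteq> 0" and k: "k \<noteq> 0"
    and f: "f = scalar k * subst (affine p q u r s v) g"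
    using assms unfolding aff_equiv_def by blast
  obtain p' q' u' r' s' v' where D': "p' * s' - q' * r' \<noteq> 0"
    and inv: "\<And>w. subst (affine p' q' u' r' s' v') (affine p q u r s v w) = var w"
    using affine_inverse[OF D] by metis
  have "scalar (1 / k) * subst (affine p' q' u' r' s' v') f = scalar (1 / k) * scalar k * g"
    by (simp add: f subst.ev_simps subst.ev_subst inv subst_var mult.assoc)
  also have "\<dots> = g" using k by (simp flip: scalar_mult)
  finally show ?thesis unfolding aff_equiv_def using D' k by (metis divide_eq_0_iff one_neq_zero)
qed

lemma aff_equiv_trans:
  assumes "aff_equiv f g" "aff_equiv g h"
  shows "aff_equiv f h"
proof -
  obtain p q u r s v k where D: "p * s - q * r \<noteq> 0" and k: "k \<noteq> 0"
    and f: "f = scalar k * subst (affine p q u r s v) g"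
    using assms unfolding aff_equiv_def by blast
  obtain p' q' u' r' s' v' k' where D': "p' * s' - q' * r' \<noteq> 0" and k': "k' \<noteq> 0"
    and g: "g = scalar k' * subst (affine p' q' u' r' s' v') h"
    using assms unfolding aff_equiv_def by blast
  have "(p' * p + q' * r) * (r' * q + s' * s) - (p' * q + q' * s) * (r' * p + s' * r)
      = (p' * s' - q' * r') * (p * s - q * r)" by (simp add: algebra_simps)
  then have "(p' * p + q' * r) * (r' * q + s' * s) - (p' * q + q' * s) * (r' * p + s' * r) \<noteq> 0"
    using D D' by simp
  moreover have "k * k' \<noteq> 0" using k k' by simp
  moreover have "f = scalar (k * k') * subst (affine (p' * p + q' * r) (p' * q + q' * s)
      (p' * u + q' * v + u') (r' * p + s' * r) (r' * q + s' * s) (r' * u + s' * v + v')) h"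
    by (simp add: f g subst.ev_simps subst.ev_subst subst_affine_affine scalar_mult mult.assoc)
  ultimately show ?thesis unfolding aff_equiv_def by blast
qed

lemma aff_equiv_imp_isomorphic:
  assumes "aff_equiv f g"
  shows "presented_algebra f \<cong>\<^sub>a presented_algebra g"
proof -
  obtain p q u r s v k where D: "p * s - q * r \<noteq> 0" and k: "k \<noteq> 0"
    and f: "f = scalar k * subst (affine p q u r s v) g"
    using assms unfolding aff_equiv_def by blast
  obtain p' q' u' r' s' v' where
    inv: "\<And>w. subst (affine p q u r s v) (affine p' q' u' r' s' v' w) = var w"
      "\<And>w. subst (affine p' q' u' r' s' v') (affine p q u r s v w) = var w"
    using affine_inverse[OF D] by metis
  show ?thesis by (rule isomorphic_of_automorphism[OF inv(2,1) k f])
qed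

lemma subst_affine_quadratic:
  "scalar k * subst (affine p q u r s v) (quadratic a b c d \<alpha> \<beta> \<gamma>) = quadratic
    (k * (a * p * p + (b + c) * p * r + d * r * r))
    (k * (a * p * q + b * p * s + c * r * q + d * r * s))
    (k * (a * p * q + b * q * r + c * s * p + d * r * s))
    (k * (a * q * q + (b + c) * q * s + d * s * s))
    (k * (a * (p * u + u * p) + (b + c) * (p * v + r * u) + d * (r * v + v * r) + \<alpha> * p + \<beta> * r))
    (k * (a * (q * u + u * q) + (b + c) * (q * v + s * u) + d * (s * v + v * s) + \<alpha> * q + \<beta> * s))
    (k * (a * u * u + (b + c) * u * v + d * v * v + \<alpha> * u + \<beta> * v + \<gamma>))"
  by (simp only: quadratic_def affine_def subst.ev_simps gen.case scalar_expand add_ac)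

lemma defining_matrix_quadratic:
  "defining_matrix (quadratic a b c d \<alpha> \<beta> \<gamma>) =
    vector [vector [a, b, \<alpha>], vector [c, d, \<beta>], vector [0, 0, \<gamma>]]"
  unfolding defining_matrix_def quadratic_def Let_def
  by (simp add: scalar_def var_def mult_single lookup_add lookup_single when_def
      zero_free_monoid_def plus_free_monoid_def)

lemma quadratic_cases:
  assumes "total_degree f \<le> 2"
  obtains a b c d \<alpha> \<beta> \<gamma> where "f = quadratic a b c d \<alpha> \<beta> \<gamma>"
  using defining_matrix_expand[OF assms] that unfolding quadratic_def Let_def by blast

lemma quadratic_inject:
  "quadratic a b c d \<alpha> \<beta> \<gamma> = quadratic a' b' c' d' \<alpha>' \<beta>' \<gamma>' \<longleftrightarrow>
    a = a' \<and> b = b' \<and> c = c' \<and> d = d' \<and> \<alpha> = \<alpha>' \<and> \<beta> = \<beta>' \<and> \<gamma> = \<gamma>'"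
proof
  assume "quadratic a b c d \<alpha> \<beta> \<gamma> = quadratic a' b' c' d' \<alpha>' \<beta>' \<gamma>'"
  then have "defining_matrix (quadratic a b c d \<alpha> \<beta> \<gamma>) = defining_matrix (quadratic a' b' c' d' \<alpha>' \<beta>' \<gamma>')"
    by simp
  then show "a = a' \<and> b = b' \<and> c = c' \<and> d = d' \<and> \<alpha> = \<alpha>' \<and> \<beta> = \<beta>' \<and> \<gamma> = \<gamma>'"
    unfolding defining_matrix_quadratic vec_eq_iff forall_3 by simp
qed simp

lemma sf_defining_matrix: "sf (defining_matrix f) = defining_matrix f"
  by (simp add: sf_def block_matrix_def defining_matrix_def Let_def)

text \<open>
  A change of variables by \<open>P\<close> turns \<open>v\<^sup>T N v\<close> into \<open>v\<^sup>T (P\<^sup>T N P) v\<close>. The standard form adds the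
  coefficients of a variable that arise from multiplication by a constant on the left and on the
  right.
\<close>

lemma sf_transform:
  assumes "P = block_matrix P1 P2 0 1"
  shows "(\<chi> i j. k * sf (transpose P ** defining_matrix (quadratic a b c d \<alpha> \<beta> \<gamma>) ** P) $ i $ j) =
    defining_matrix (scalar k * subst (affine (P1$1$1) (P1$1$2) (P2$1) (P1$2$1) (P1$2$2) (P2$2))
      (quadratic a b c d \<alpha> \<beta> \<gamma>))"
  unfolding subst_affine_quadratic defining_matrix_quadratic assms
  by (simp add: vec_eq_iff forall_3 sf_def block_matrix_def Let_def matrix_matrix_mult_def
      sum_3 transpose_def algebra_simps)

lemma sf_congruent_iff_aff_equiv:
  fixes f g :: "'k::field free_poly"
  assumes "total_degree f \<le> 2" "total_degree g \<le> 2"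
  shows "sf_congruent (defining_matrix f) (defining_matrix g) \<longleftrightarrow> aff_equiv f g"
proof -
  obtain a b c d \<alpha> \<beta> \<gamma> where f: "f = quadratic a b c d \<alpha> \<beta> \<gamma>" by (rule quadratic_cases[OF assms(1)])
  obtain a' b' c' d' \<alpha>' \<beta>' \<gamma>' where g: "g = quadratic a' b' c' d' \<alpha>' \<beta>' \<gamma>'"
    by (rule quadratic_cases[OF assms(2)])
  have inj: "defining_matrix f = defining_matrix (scalar k * subst (affine p q u r s v) g) \<longleftrightarrow>
      f = scalar k * subst (affine p q u r s v) g" for k p q u r s v
    unfolding g subst_affine_quadratic f quadratic_inject
    by (simp only: defining_matrix_quadratic vec_eq_iff forall_3) auto
  have inv: "invertible P \<longleftrightarrow> P$1$1 * P$2$2 - P$1$2 * P$2$1 \<noteq> 0" for P :: "'k^2^2"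
    by (simp add: invertible_det_nz det_2)
  have tr: "sf (defining_matrix f) =
        (\<chi> i j. k * sf (transpose (block_matrix P1 P2 0 1) ** defining_matrix g ** block_matrix P1 P2 0 1) $ i $ j)
      \<longleftrightarrow> f = scalar k * subst (affine (P1$1$1) (P1$1$2) (P2$1) (P1$2$1) (P1$2$2) (P2$2)) g"
    for k and P1 :: "'k^2^2" and P2 :: "'k^2"
    unfolding sf_defining_matrix inj[symmetric] unfolding g sf_transform[OF refl] ..
  have "sf_congruent (defining_matrix f) (defining_matrix g) \<longleftrightarrow>
      (\<exists>(P1::'k^2^2) (P2::'k^2) k. invertible P1 \<and> k \<noteq> 0 \<and>
        f = scalar k * subst (affine (P1$1$1) (P1$1$2) (P2$1) (P1$2$1) (P1$2$2) (P2$2)) g)"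
    unfolding sf_congruent_def P3_def tr[symmetric] by blast
  also have "\<dots> \<longleftrightarrow> aff_equiv f g"
  proof
    assume "aff_equiv f g"
    then obtain p q u r s v k where "p * s - q * r \<noteq> 0" "k \<noteq> 0"
      "f = scalar k * subst (affine p q u r s v) g" unfolding aff_equiv_def by blast
    then show "\<exists>(P1::'k^2^2) (P2::'k^2) k. invertible P1 \<and> k \<noteq> 0 \<and>
        f = scalar k * subst (affine (P1$1$1) (P1$1$2) (P2$1) (P1$2$1) (P1$2$2) (P2$2)) g"
      by (intro exI[of _ "vector [vector [p, q], vector [r, s]]"] exI[of _ "vector [u, v]"] exI[of _ k])
        (simp add: inv)
  next
    assume "\<exists>(P1::'k^2^2) (P2::'k^2) k. invertible P1 \<and> k \<noteq> 0 \<and>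
        f = scalar k * subst (affine (P1$1$1) (P1$1$2) (P2$1) (P1$2$1) (P1$2$2) (P2$2)) g"
    then show "aff_equiv f g" unfolding aff_equiv_def inv by blast
  qed
  finally show ?thesis .
qed

section \<open>Reduction to normal forms\<close>

lemma aff_equiv_quadraticI:
  assumes "p * s - q * r \<noteq> 0" "k \<noteq> 0"
    and "a' = k * (a * p * p + (b + c) * p * r + d * r * r)"
    and "b' = k * (a * p * q + b * p * s + c * r * q + d * r * s)"
    and "c' = k * (a * p * q + b * q * r + c * s * p + d * r * s)"
    and "d' = k * (a * q * q + (b + c) * q * s + d * s * s)"
    and "\<alpha>' = k * (a * (p * u + u * p) + (b + c) * (p * v + r * u) + d * (r * v + v * r) + \<alpha> * p + \<beta> * r)"
    and "\<beta>' = k * (a * (q * u + u * q) + (b + c) * (q * v + s * u) + d * (s * v + v * s) + \<alpha> * q + \<beta> * s)"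
    and "\<gamma>' = k * (a * u * u + (b + c) * u * v + d * v * v + \<alpha> * u + \<beta> * v + \<gamma>)"
  shows "aff_equiv (quadratic a b c d \<alpha> \<beta> \<gamma>) (quadratic a' b' c' d' \<alpha>' \<beta>' \<gamma>')"
proof (rule aff_equiv_sym)
  have "quadratic a' b' c' d' \<alpha>' \<beta>' \<gamma>' =
      scalar k * subst (affine p q u r s v) (quadratic a b c d \<alpha> \<beta> \<gamma>)"
    unfolding subst_affine_quadratic quadratic_inject using assms(3-) by blast
  with assms(1,2) show "aff_equiv (quadratic a' b' c' d' \<alpha>' \<beta>' \<gamma>') (quadratic a b c d \<alpha> \<beta> \<gamma>)"
    unfolding aff_equiv_def by blast
qed

definition U_form :: "'k::field free_poly"
  where "U_form = quadratic 0 (- 1) 1 0 0 1 0"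

definition V_form :: "'k::field free_poly"
  where "V_form = quadratic 0 (- 1) 1 1 1 0 0"

definition normal_form :: "'k::field free_poly \<Rightarrow> bool"
  where "normal_form n \<longleftrightarrow> n = parabola_form \<or>
    (\<exists>e\<in>{0, 1}. (\<exists>q. n = q_form q e) \<or> n = jordan_form e \<or> n = square_form e)"

lemma q_form_constant: "\<exists>e\<in>{0, 1}. aff_equiv (q_form q \<gamma>) (q_form q e)"
proof (cases "\<gamma> = 0")
  case True
  then show ?thesis using aff_equiv_refl by blast
next
  case False
  then have "aff_equiv (q_form q \<gamma>) (q_form q 1)"
    unfolding q_form_def
    by (intro aff_equiv_quadraticI[where p = \<gamma> and q = 0 and r = 0 and s = 1 and u = 0 and v = 0
          and k = "1 / \<gamma>"]) auto
  then show ?thesis by blast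
qed

text \<open>
  Exchange the variables and rescale.
\<close>

lemma q_form_inverse:
  assumes "q \<noteq> 0"
  shows "aff_equiv (q_form q e) (q_form (1 / q) e)"
  unfolding q_form_def using assms
  by (intro aff_equiv_quadraticI[where p = 0 and q = "- 1 / q" and r = 1 and s = 0 and u = 0 and v = 0
        and k = 1]) auto

lemma square_root:
  fixes c :: "'k::alg_closed_field"
  obtains r where "r * r = c"
  using square_root_of_minus[of "- c"] by auto

lemma jordan_form_constant:
  fixes \<gamma> :: "'k::alg_closed_field"
  shows "\<exists>e\<in>{0, 1}. aff_equiv (jordan_form \<gamma>) (jordan_form e)"
proof (cases "\<gamma> = 0")
  case True
  then show ?thesis using aff_equiv_refl by blast
next
  case False
  obtain r where r: "r * r = \<gamma>" by (rule square_root)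
  then have "r \<noteq> 0" using False by auto
  then have "aff_equiv (jordan_form \<gamma>) (jordan_form 1)"
    unfolding jordan_form_def r[symmetric]
    by (intro aff_equiv_quadraticI[where p = r and q = 0 and r = 0 and s = r and u = 0 and v = 0
          and k = "1 / (r * r)"]) auto
  then show ?thesis by blast
qed

lemma square_form_constant:
  fixes \<gamma> :: "'k::alg_closed_field"
  shows "\<exists>e\<in>{0, 1}. aff_equiv (square_form \<gamma>) (square_form e)"
proof (cases "\<gamma> = 0")
  case True
  then show ?thesis using aff_equiv_refl by blast
next
  case False
  obtain r where r: "r * r = \<gamma>" by (rule square_root)
  then have "r \<noteq> 0" using False by auto
  then have "aff_equiv (square_form \<gamma>) (square_form 1)"
    unfolding square_form_def r[symmetric]
    by (intro aff_equiv_quadraticI[where p = 1 and q = 0 and r = 0 and s = r and u = 0 and v = 0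
          and k = "1 / (r * r)"]) auto
  then show ?thesis by blast
qed

text \<open>
  The quadratic form \<open>a x\<^sup>2 + (b + c) xy + d y\<^sup>2\<close> has a nontrivial zero over an algebraically closed
  field. Taking it as the first basis vector kills the coefficient of \<open>x\<^sup>2\<close>.
\<close>

lemma isotropic_equivalent:
  fixes a :: "'k::alg_closed_field"
  assumes "(a, b, c, d) \<noteq> (0, 0, 0, 0)"
  shows "\<exists>b' c' d' \<alpha>' \<beta>' \<gamma>'. (b', c', d') \<noteq> (0, 0, 0) \<and>
    aff_equiv (quadratic a b c d \<alpha> \<beta> \<gamma>) (quadratic 0 b' c' d' \<alpha>' \<beta>' \<gamma>')"
proof (cases "a = 0")
  case True
  then show ?thesis using assms aff_equiv_refl by blast
next
  case False
  then have "degree [:d, b + c, a:] > 0" by simp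
  then obtain t where "poly [:d, b + c, a:] t = 0" using alg_closed_imp_poly_has_root by blast
  then have t: "a * t * t + (b + c) * t + d = 0"
    by (simp add: algebra_simps)
  have "aff_equiv (quadratic a b c d \<alpha> \<beta> \<gamma>)
      (quadratic 0 (a * t + c) (a * t + b) a (\<alpha> * t + \<beta>) \<alpha> \<gamma>)"
    by (rule aff_equiv_quadraticI[where p = t and q = 1 and r = 1 and s = 0 and u = 0 and v = 0
          and k = 1]) (simp_all add: t)
  with False show ?thesis by blast
qed

text \<open>
  If \<open>b + c\<close> is nonzero, adding a multiple of \<open>y\<close> to \<open>x\<close> removes \<open>y\<^sup>2\<close>, and a translation then removes the
  linear terms.
\<close>

lemma nonsymplectic_normal_form:
  fixes b c d \<alpha> \<beta> \<gamma> :: "'k::field"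
  assumes bc: "b + c \<noteq> 0"
  shows "\<exists>q. \<exists>e\<in>{0, 1}. aff_equiv (quadratic 0 b c d \<alpha> \<beta> \<gamma>) (q_form q e)"
proof -
  have main: "\<exists>q. \<exists>e\<in>{0, 1}. aff_equiv (quadratic 0 b c 0 \<alpha> \<beta> \<gamma>) (q_form q e)"
    if b: "b \<noteq> 0" and bc: "b + c \<noteq> 0" for b c \<alpha> \<beta> \<gamma> :: 'k
  proof -
    define u v where "u = - \<beta> / (b + c)" and "v = - \<alpha> / (b + c)"
    have "aff_equiv (quadratic 0 b c 0 \<alpha> \<beta> \<gamma>)
        (q_form (- c / b) ((1 / b) * ((b + c) * u * v + \<alpha> * u + \<beta> * v + \<gamma>)))"
      unfolding q_form_def using b bc
      by (intro aff_equiv_quadraticI[where p = 1 and q = 0 and r = 0 and s = 1 and u = u and v = v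
          and k = "1 / b"]) (simp_all add: u_def v_def)
    then show ?thesis using q_form_constant aff_equiv_trans by blast
  qed
  define \<beta>' where "\<beta>' = \<alpha> * (- d / (b + c)) + \<beta>"
  have 1: "aff_equiv (quadratic 0 b c d \<alpha> \<beta> \<gamma>) (quadratic 0 b c 0 \<alpha> \<beta>' \<gamma>)"
    using bc unfolding \<beta>'_def
    by (intro aff_equiv_quadraticI[where p = 1 and q = "- d / (b + c)" and r = 0 and s = 1
          and u = 0 and v = 0 and k = 1]) simp_all
  show ?thesis
  proof (cases "b = 0")
    case False
    then show ?thesis using main[OF _ bc] 1 aff_equiv_trans by blast
  next
    case True
    have "aff_equiv (quadratic 0 b c 0 \<alpha> \<beta>' \<gamma>) (quadratic 0 c b 0 \<beta>' \<alpha> \<gamma>)"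
      by (intro aff_equiv_quadraticI[where p = 0 and q = 1 and r = 1 and s = 0 and u = 0 and v = 0
            and k = 1]) simp_all
    moreover have "c \<noteq> 0" "c + b \<noteq> 0" using bc True by auto
    ultimately show ?thesis using main 1 aff_equiv_trans by meson
  qed
qed

text \<open>
  Translations do not change the linear part of \<open>xy - yx + \<alpha>x + \<beta>y + \<gamma>\<close>. If this part is nonzero, a
  substitution of determinant \<open>-1\<close> turns it into \<open>y\<close>, and a translation then removes the constant.
\<close>

lemma commutator_normal_form:
  assumes b: "b \<noteq> (0::'k::field)"
  shows "aff_equiv (quadratic 0 b (- b) 0 \<alpha> \<beta> \<gamma>) U_form \<or>
    (\<exists>e\<in>{0, 1}. aff_equiv (quadratic 0 b (- b) 0 \<alpha> \<beta> \<gamma>) (q_form 1 e))"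
proof -
  define A B C where "A = \<alpha> / b" and "B = \<beta> / b" and "C = \<gamma> / b"
  have 1: "aff_equiv (quadratic 0 b (- b) 0 \<alpha> \<beta> \<gamma>) (quadratic 0 1 (- 1) 0 A B C)"
    using b unfolding A_def B_def C_def
    by (intro aff_equiv_quadraticI[where p = 1 and q = 0 and r = 0 and s = 1 and u = 0 and v = 0
          and k = "1 / b"]) simp_all
  consider "A = 0" "B = 0" | "A \<noteq> 0" | "A = 0" "B \<noteq> 0" by blast
  then show ?thesis
  proof cases
    case 1
    then have "aff_equiv (quadratic 0 b (- b) 0 \<alpha> \<beta> \<gamma>) (q_form 1 C)"
      using \<open>aff_equiv _ (quadratic 0 1 (- 1) 0 A B C)\<close> by (simp add: q_form_def)
    then show ?thesis using q_form_constant aff_equiv_trans by blast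
  next
    case 2
    then have "aff_equiv (quadratic 0 1 (- 1) 0 A B C) U_form"
      unfolding U_form_def
      by (intro aff_equiv_quadraticI[where p = "- B" and q = "1 / A" and r = A and s = 0
            and u = "- C / A" and v = 0 and k = 1]) simp_all
    then show ?thesis using 1 aff_equiv_trans by blast
  next
    case 3
    then have "aff_equiv (quadratic 0 1 (- 1) 0 A B C) U_form"
      unfolding U_form_def
      by (intro aff_equiv_quadraticI[where p = "- B" and q = 0 and r = 0 and s = "1 / B"
            and u = 0 and v = "- C / B" and k = 1]) simp_all
    then show ?thesis using 1 aff_equiv_trans by blast
  qed
qed

text \<open>
  Completing the square removes the linear term in \<open>y\<close>. The coefficient of \<open>x\<close> cannot be removed by a
  translation; if it is nonzero, the translations along \<open>x\<close> remove the constant instead.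
\<close>

lemma jordan_normal_form:
  fixes b d \<alpha> \<beta> \<gamma> :: "'k::{alg_closed_field,field_char_0}"
  assumes b: "b \<noteq> 0" and d: "d \<noteq> 0"
  shows "aff_equiv (quadratic 0 b (- b) d \<alpha> \<beta> \<gamma>) V_form \<or>
    (\<exists>e\<in>{0, 1}. aff_equiv (quadratic 0 b (- b) d \<alpha> \<beta> \<gamma>) (jordan_form e))"
proof -
  define A B C where "A = - \<alpha> / b" and "B = \<beta> / d" and "C = \<gamma> / d"
  have 1: "aff_equiv (quadratic 0 b (- b) d \<alpha> \<beta> \<gamma>) (quadratic 0 (- 1) 1 1 A B C)"
    using b d unfolding A_def B_def C_def
    by (intro aff_equiv_quadraticI[where p = "- d / b" and q = 0 and r = 0 and s = 1
          and u = 0 and v = 0 and k = "1 / d"]) simp_all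
  define D where "D = C - B * B / 4"
  have 2: "aff_equiv (quadratic 0 (- 1) 1 1 A B C) (quadratic 0 (- 1) 1 1 A 0 D)"
    by (intro aff_equiv_quadraticI[where p = 1 and q = 0 and r = 0 and s = 1
          and u = 0 and v = "- B / 2" and k = 1]) (simp_all add: D_def field_simps)
  show ?thesis
  proof (cases "A = 0")
    case True
    then have "aff_equiv (quadratic 0 b (- b) d \<alpha> \<beta> \<gamma>) (jordan_form D)"
      using aff_equiv_trans[OF 1 2] by (simp add: jordan_form_def)
    then show ?thesis using jordan_form_constant aff_equiv_trans by blast
  next
    case False
    then have "aff_equiv (quadratic 0 (- 1) 1 1 A 0 D) V_form"
      unfolding V_form_def
      by (intro aff_equiv_quadraticI[where p = A and q = 0 and r = 0 and s = A
            and u = "- D / A" and v = 0 and k = "1 / (A * A)"]) simp_all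
    then show ?thesis using aff_equiv_trans[OF 1 2] aff_equiv_trans by blast
  qed
qed

lemma square_normal_form:
  fixes d \<alpha> \<beta> \<gamma> :: "'k::{alg_closed_field,field_char_0}"
  assumes d: "d \<noteq> 0"
  shows "aff_equiv (quadratic 0 0 0 d \<alpha> \<beta> \<gamma>) parabola_form \<or>
    (\<exists>e\<in>{0, 1}. aff_equiv (quadratic 0 0 0 d \<alpha> \<beta> \<gamma>) (square_form e))"
proof -
  define A B C where "A = \<alpha> / d" and "B = \<beta> / d" and "C = \<gamma> / d"
  have 1: "aff_equiv (quadratic 0 0 0 d \<alpha> \<beta> \<gamma>) (quadratic 0 0 0 1 A B C)"
    using d unfolding A_def B_def C_def
    by (intro aff_equiv_quadraticI[where p = 1 and q = 0 and r = 0 and s = 1 and u = 0 and v = 0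
          and k = "1 / d"]) simp_all
  define D where "D = C - B * B / 4"
  have 2: "aff_equiv (quadratic 0 0 0 1 A B C) (quadratic 0 0 0 1 A 0 D)"
    by (intro aff_equiv_quadraticI[where p = 1 and q = 0 and r = 0 and s = 1
          and u = 0 and v = "- B / 2" and k = 1]) (simp_all add: D_def field_simps)
  show ?thesis
  proof (cases "A = 0")
    case True
    then have "aff_equiv (quadratic 0 0 0 d \<alpha> \<beta> \<gamma>) (square_form D)"
      using aff_equiv_trans[OF 1 2] by (simp add: square_form_def)
    then show ?thesis using square_form_constant aff_equiv_trans by blast
  next
    case False
    then have "aff_equiv (quadratic 0 0 0 1 A 0 D) parabola_form"
      unfolding parabola_form_def
      by (intro aff_equiv_quadraticI[where p = "1 / A" and q = 0 and r = 0 and s = 1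
            and u = "- D / A" and v = 0 and k = 1]) simp_all
    then show ?thesis using aff_equiv_trans[OF 1 2] aff_equiv_trans by blast
  qed
qed

text \<open>
  The cases are distinguished by the symmetric part of the quadratic form: once the coefficient of
  \<open>x\<^sup>2\<close> vanishes, either \<open>b + c \<noteq> 0\<close>, or the quadratic part is \<open>b (xy - yx) + d y\<^sup>2\<close>.
\<close>

lemma quadratic_classification:
  fixes a b c d \<alpha> \<beta> \<gamma> :: "'k::{alg_closed_field,field_char_0}"
  assumes "(a, b, c, d) \<noteq> (0, 0, 0, 0)"
  obtains n where "aff_equiv (quadratic a b c d \<alpha> \<beta> \<gamma>) n" "normal_form n \<or> n = U_form \<or> n = V_form"
proof -
  obtain b' c' d' \<alpha>' \<beta>' \<gamma>' where nz: "(b', c', d') \<noteq> (0, 0, 0)"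
    and eq: "aff_equiv (quadratic a b c d \<alpha> \<beta> \<gamma>) (quadratic 0 b' c' d' \<alpha>' \<beta>' \<gamma>')"
    using isotropic_equivalent[OF assms, of \<alpha> \<beta> \<gamma>] by blast
  have "\<exists>n. aff_equiv (quadratic 0 b' c' d' \<alpha>' \<beta>' \<gamma>') n \<and> (normal_form n \<or> n = U_form \<or> n = V_form)"
  proof (cases "b' + c' = 0")
    case False
    from nonsymplectic_normal_form[OF this, of d' \<alpha>' \<beta>' \<gamma>'] show ?thesis
      unfolding normal_form_def by blast
  next
    case True
    then have c': "c' = - b'" by (simp add: add_eq_0_iff)
    consider "b' \<noteq> 0" "d' = 0" | "b' \<noteq> 0" "d' \<noteq> 0" | "b' = 0" "d' \<noteq> 0"
      using nz c' by auto
    then show ?thesis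
    proof cases
      case 1
      from commutator_normal_form[OF 1(1), of \<alpha>' \<beta>' \<gamma>'] show ?thesis
        unfolding c' \<open>d' = 0\<close> normal_form_def by blast
    next
      case 2
      from jordan_normal_form[OF 2, of \<alpha>' \<beta>' \<gamma>'] show ?thesis
        unfolding c' normal_form_def by blast
    next
      case 3
      from square_normal_form[OF 3(2), of \<alpha>' \<beta>' \<gamma>'] show ?thesis
        unfolding c' \<open>b' = 0\<close> minus_zero normal_form_def by blast
    qed
  qed
  then show ?thesis using aff_equiv_trans[OF eq] that by blast
qed

lemma total_degree_2_quadratic:
  fixes f :: "'k::field free_poly"
  assumes "total_degree f = 2"
  obtains a b c d \<alpha> \<beta> \<gamma> where "f = quadratic a b c d \<alpha> \<beta> \<gamma>" "(a, b, c, d) \<noteq> (0, 0, 0, 0)"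
proof -
  obtain a b c d \<alpha> \<beta> \<gamma> where f: "f = quadratic a b c d \<alpha> \<beta> \<gamma>"
    by (rule quadratic_cases[of f]) (use assms in auto)
  have "(a, b, c, d) \<noteq> (0, 0, 0, 0)"
  proof
    assume 0: "(a, b, c, d) = (0, 0, 0, 0)"
    have "length (letters w) \<le> 1" if "w \<in> Poly_Mapping.keys f" for w
    proof -
      have "Poly_Mapping.lookup f w \<noteq> 0" using that by (simp add: in_keys_iff)
      moreover have "f = Poly_Mapping.single (Word [X]) \<alpha> + Poly_Mapping.single (Word [Y]) \<beta>
          + Poly_Mapping.single (Word []) \<gamma>"
        using 0 by (simp add: f quadratic_def scalar_def var_def mult_single zero_free_monoid_def
            plus_free_monoid_def)
      ultimately show ?thesis
        by (auto simp: lookup_add lookup_single when_def split: if_splits)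
    qed
    then have "total_degree f \<le> 1"
      unfolding total_degree_def by (auto simp: Max_le_iff)
    with assms show False by simp
  qed
  with f show ?thesis by (rule that)
qed

section \<open>Distinguishing the normal forms\<close>

text \<open>
  The tables of invariants exclude all pairs of different families except the following: the relations
  \<open>xy - qyx + 1\<close> against \<open>y\<^sup>2 + x\<close> or \<open>yx - xy + y\<^sup>2 + 1\<close>, whose conics contain curves
  parametrised by a line, and the plane of
  \<open>xy - yx\<close> against the line of \<open>yx - xy + y\<^sup>2\<close>.
\<close>

lemma isomorphic_normal_forms:
  fixes n m :: "'k::{alg_closed_field,field_char_0} free_poly"
  assumes n: "normal_form n" and m: "normal_form m"
    and iso: "presented_algebra n \<cong>\<^sub>a presented_algebra m"
  shows "aff_equiv n m"
proof -
  obtain \<phi> \<psi> where emb: "point_embedding n m \<phi> \<psi>" "point_embedding m n \<psi> \<phi>"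
    using isomorphic_point_embeddings[OF iso] by blast
  note inv = point_embedding_invariants[OF emb]
  note tab = invariants_q_form invariants_q_form_1 invariants_jordan_form invariants_square_form
    invariants_parabola_form
  have forms: "(\<exists>q. k = q_form q 0) \<or> (\<exists>q. k = q_form q 1) \<or> k = jordan_form 0 \<or> k = jordan_form 1
      \<or> k = square_form 0 \<or> k = square_form 1 \<or> k = parabola_form" if "normal_form k" for k :: "'k free_poly"
    using that unfolding normal_form_def by blast
  have inverse: "aff_equiv (q_form q e) (q_form r e)" if "q = r \<or> q * r = 1" for q r e :: 'k
  proof (cases "q = r")
    case False
    then have "q \<noteq> 0" "r = 1 / q" using that by (auto simp: divide_simps mult.commute)
    then show ?thesis using q_form_inverse by blast
  qed (simp add: aff_equiv_refl)
  have no_line: False if "l = jordan_form 1 \<or> l = parabola_form" "point_embedding l (q_form q 1) \<xi> \<zeta>"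
    for q :: 'k and l \<xi> \<zeta>
  proof -
    obtain i :: 'k where i: "i * i + 1 = 0" by (rule square_root_of_minus)
    from that(1) show False
    proof
      assume "l = jordan_form 1"
      with no_line_on_hyperbola[OF that(2), of "[:0, 1:]" "[:i:]"] i show False
        by (simp add: pts_forms)
    next
      assume "l = parabola_form"
      with no_line_on_hyperbola[OF that(2), of "[:0, 0, - 1:]" "[:0, 1:]"] show False
        by (simp add: pts_forms)
    qed
  qed
  have plane: False if "point_embedding (q_form 1 0) (jordan_form (0::'k)) \<xi> \<zeta>" for \<xi> \<zeta>
  proof (rule no_plane_on_line[OF that])
    show "pts (q_form 1 (0::'k)) = UNIV" by (auto simp: set_eq_iff pts_forms)
  qed
  from forms[OF n] show ?thesis
  proof (elim disjE exE)
    fix q assume n: "n = q_form q 0"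
    from forms[OF m] show ?thesis
    proof (elim disjE exE)
      fix r assume m: "m = q_form r 0"
      show ?thesis
      proof (cases "r = 1")
        case True
        then show ?thesis using inv(5) by (simp add: n m tab aff_equiv_refl)
      next
        case False
        then show ?thesis using q_form_0_parameter emb(1) inverse unfolding n m by blast
      qed
    next
      assume m: "m = jordan_form 0"
      then have "q = 1" using inv(5) by (simp add: n tab)
      then show ?thesis using plane emb(1) unfolding n m by blast
    qed (use inv in \<open>auto simp: n tab\<close>)
  next
    fix q assume n: "n = q_form q 1"
    from forms[OF m] show ?thesis
    proof (elim disjE exE)
      fix r assume m: "m = q_form r 1"
      show ?thesis
      proof (cases "q = 0 \<or> q = 1")
        case True
        then have "q = r" using inv(1,2) by (auto simp: n m tab)
        then show ?thesis by (simp add: n m aff_equiv_refl)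
      next
        case False
        then show ?thesis using q_form_1_parameter emb(1) inverse unfolding n m by blast
      qed
    qed (use inv no_line emb in \<open>auto simp: n tab\<close>)
  next
    assume n: "n = jordan_form 0"
    from forms[OF m] show ?thesis
    proof (elim disjE exE)
      fix q assume m: "m = q_form q 0"
      then have "q = 1" using inv(5) by (simp add: n tab)
      then show ?thesis using plane emb(2) unfolding n m by blast
    qed (use inv in \<open>auto simp: n tab aff_equiv_refl\<close>)
  next
    assume n: "n = jordan_form 1"
    from forms[OF m] show ?thesis
      by (elim disjE exE) (use inv no_line emb in \<open>auto simp: n tab aff_equiv_refl\<close>)
  next
    assume n: "n = square_form 0"
    from forms[OF m] show ?thesis
      by (elim disjE exE) (use inv in \<open>auto simp: n tab aff_equiv_refl\<close>)
  next
    assume n: "n = square_form 1"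
    from forms[OF m] show ?thesis
      by (elim disjE exE) (use inv in \<open>auto simp: n tab aff_equiv_refl\<close>)
  next
    assume n: "n = parabola_form"
    from forms[OF m] show ?thesis
      by (elim disjE exE) (use inv no_line emb in \<open>auto simp: n tab aff_equiv_refl\<close>)
  qed
qed

section \<open>The exceptional pair and the classification\<close>

lemma algebra_U_form: "algebra_U = presented_algebra U_form"
  unfolding algebra_U_def U_form_def quadratic_def by (simp add: scalar_minus)

lemma algebra_V_form: "algebra_V = presented_algebra V_form"
  unfolding algebra_V_def V_form_def quadratic_def by (simp add: scalar_minus power2_eq_square)

text \<open>
  With \<open>x\<close> and \<open>y\<close> replaced by \<open>y - x\<^sup>2\<close> and \<open>-x\<close>, the commutator \<open>yx - xy\<close> becomes \<open>yx - xy\<close> again, and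
  \<open>y\<^sup>2 + x\<close> becomes \<open>y\<close>.
\<close>

lemma U_isomorphic_V:
  "presented_algebra (U_form :: 'k::field free_poly) \<cong>\<^sub>a presented_algebra (V_form :: 'k free_poly)"
proof (rule isomorphic_of_automorphism)
  let ?\<phi> = "case_gen (var Y - var X * var X) (- var X) :: gen \<Rightarrow> 'k free_poly"
  let ?\<psi> = "case_gen (- var Y) (var X + var Y * var Y) :: gen \<Rightarrow> 'k free_poly"
  show "subst ?\<psi> (?\<phi> v) = var v" "subst ?\<phi> (?\<psi> v) = var v" for v
    by (cases v; simp add: subst.ev_simps)+
  show "U_form = scalar 1 * subst ?\<phi> V_form"
    by (simp add: U_form_def V_form_def quadratic_def subst.ev_simps scalar_minus
        algebra_simps)
qed simp

theorem theorem5p7: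
  fixes f f' :: "'k::{alg_closed_field,field_char_0} free_poly"
    and M M' :: "'k^3^3"
  assumes "total_degree f = 2" and "total_degree f' = 2"
    and "M = defining_matrix f" and "M' = defining_matrix f'"
  shows "(sf_congruent M M' \<longrightarrow> presented_algebra f \<cong>\<^sub>a presented_algebra f') \<and>
    (presented_algebra f \<cong>\<^sub>a presented_algebra f' \<longrightarrow>
      \<not> (presented_algebra f \<cong>\<^sub>a algebra_U \<and> presented_algebra f' \<cong>\<^sub>a algebra_V \<or>
         presented_algebra f \<cong>\<^sub>a algebra_V \<and> presented_algebra f' \<cong>\<^sub>a algebra_U) \<longrightarrow>
      sf_congruent M M')"
proof -
  have sf: "sf_congruent M M' \<longleftrightarrow> aff_equiv f f'"
    using sf_congruent_iff_aff_equiv[of f f'] assms by simp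
  have nf: "\<exists>n. aff_equiv g n \<and> normal_form n"
    if deg: "total_degree g = 2" and iso: "\<not> presented_algebra g \<cong>\<^sub>a presented_algebra U_form"
    for g :: "'k free_poly"
  proof -
    obtain a b c d \<alpha> \<beta> \<gamma> where "g = quadratic a b c d \<alpha> \<beta> \<gamma>" "(a, b, c, d) \<noteq> (0, 0, 0, 0)"
      using total_degree_2_quadratic[OF deg] by blast
    then obtain n where n: "aff_equiv g n" "normal_form n \<or> n = U_form \<or> n = V_form"
      using quadratic_classification by metis
    have "n \<noteq> U_form" "n \<noteq> V_form"
      using iso aff_equiv_imp_isomorphic[OF n(1)] alg_isomorphic_trans
        alg_isomorphic_sym[OF U_isomorphic_V] by blast+
    with n show ?thesis by blast
  qed
  have "aff_equiv f f'"
    if iso: "presented_algebra f \<cong>\<^sub>a presented_algebra f'"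
      and not_U: "\<not> (presented_algebra f \<cong>\<^sub>a algebra_U \<and> presented_algebra f' \<cong>\<^sub>a algebra_V \<or>
         presented_algebra f \<cong>\<^sub>a algebra_V \<and> presented_algebra f' \<cong>\<^sub>a algebra_U)"
  proof -
    have iso': "presented_algebra f' \<cong>\<^sub>a presented_algebra f"
      by (rule alg_isomorphic_sym[OF iso])
    have f: "\<not> presented_algebra f \<cong>\<^sub>a presented_algebra U_form"
    proof
      \<comment> \<open>then both algebras are isomorphic to \<open>\<UU>\<close> and to \<open>\<VV>\<close>, which is the exceptional case\<close>
      assume fU: "presented_algebra f \<cong>\<^sub>a presented_algebra U_form"
      from alg_isomorphic_trans[OF alg_isomorphic_trans[OF iso' fU] U_isomorphic_V]
      show False using fU not_U unfolding algebra_U_form algebra_V_form by blast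
    qed
    then have f': "\<not> presented_algebra f' \<cong>\<^sub>a presented_algebra U_form"
      using alg_isomorphic_trans[OF iso] by blast
    obtain n where n: "aff_equiv f n" "normal_form n" using nf[OF assms(1) f] by blast
    obtain m where m: "aff_equiv f' m" "normal_form m" using nf[OF assms(2) f'] by blast
    have "presented_algebra n \<cong>\<^sub>a presented_algebra m"
      using alg_isomorphic_trans alg_isomorphic_trans iso
        aff_equiv_imp_isomorphic[OF aff_equiv_sym[OF n(1)]] aff_equiv_imp_isomorphic[OF m(1)] by blast
    then have "aff_equiv n m" by (rule isomorphic_normal_forms[OF n(2) m(2)])
    then show ?thesis using n(1) aff_equiv_sym[OF m(1)] aff_equiv_trans by blast
  qed
  then show ?thesis
    unfolding sf using aff_equiv_imp_isomorphic by blast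
qed

end
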